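(* If $D_1$ and $D_2$ are diagrams of the same (classical or virtual) knot, then the looped interlacement graphs $\mathcal{L}(D_1)$ and $\mathcal{L}(D_2)$ are Reidemeister equivalent as graphs.
   Context: Graphs are finite, undirected, may have loops (at most one per vertex), and have no multiple edges; the empty graph is allowed. Graphs are considered up to isomorphism. Diagrams. A knot diagram $D$ is a plane diagram of a one-component classical or virtual knot; crossings are classical (with over/under information) or, for virtual knots, virtual. Two classical diagrams represent the same classical knot if and only if they are related by the usual Reidemeister moves (and planar isotopy); two virtual diagrams represent the same virtual knot if and only if they are related by the usual Reidemeister moves on classical crossings together with the additional moves of virtual knot theory (virtual Reidemeister moves I, II, III, and the mixed move in which an arc with only virtual crossings is moved past a classical crossing), and planar isotopy. Each classical crossing is positive or negative in the usual sense (for a one-component diagram the sign does not depend on the orientation chosen). Looped interlacement graph. $\mathcal{L}(D)$ has one vertex for each classical crossing of $D$. Two distinct vertices are adjacent if and only if the corresponding crossings are interlaced in $D$, i.e. while tracing $D$ one encounters first one crossing, then the other, then the first again, and finally the second again (cyclically). $\mathcal{L}(D)$ has a loop at each vertex that corresponds to a negative crossing of $D$, and no other loops. Reidemeister equivalence of graphs. Two graphs are Reidemeister equivalent if one can be obtained from the other by a finite sequence of the following moves. $\Omega.1$: adjoin or remove an isolated vertex (i.e. a vertex not adjacent to any other vertex), which may be looped or unlooped. $\Omega.2$: adjoin or remove two vertices $v$ and $w$ such that (i) $v$ is looped, (ii) $w$ is not looped, and (iii) every vertex $x\notin\{v,w\}$ that is adjacent to one of $v,w$ is also adjacent to the other.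 The vertices $v$ and $w$ may be adjacent or nonadjacent. $\Omega.3$: toggle (insert if absent, remove if present) all three non-loop adjacencies among three distinct vertices $u,v,w$, provided that (i) every vertex $x\notin\{u,v,w\}$ that is adjacent to any of $u,v,w$ is adjacent to precisely two of $u,v,w$, and (ii) either the initial or the terminal subgraph spanned by $u,v,w$ (including loops) is isomorphic to one of these six three-vertex graphs: (1) the three-vertex path with all three vertices looped; (2) the three-vertex path with no loops; (3) the three-vertex path with loops at the middle vertex and at exactly one end vertex; (4) the three-vertex path with a loop at exactly one end vertex and no other loops; (5) the triangle with loops at exactly two vertices; (6) the triangle with a loop at exactly one vertex. *)

theory Defs
  imports "HOL-Analysis.Analysis"
begin

section \<open>Looped graphs and Reidemeister equivalence\<close>

text \<open>An edge is a set of vertices: a doubleton joins two distinct vertices, a singleton is a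
  loop. Hence there is at most one loop per vertex and there are no multiple edges.\<close>

record 'v graph =
  verts :: "'v set"
  edges :: "'v set set"

definition finite_graph :: "'v graph \<Rightarrow> bool" where
  "finite_graph G \<longleftrightarrow>
     finite (verts G) \<and> (\<forall>e\<in>edges G. \<exists>u\<in>verts G. \<exists>v\<in>verts G. e = {u, v})"

definition graph_iso :: "'v graph \<Rightarrow> 'w graph \<Rightarrow> bool" where
  "graph_iso G H \<longleftrightarrow>
     (\<exists>f. bij_betw f (verts G) (verts H) \<and> edges H = (\<lambda>e. f ` e) ` edges G)"

definition adjacent :: "'v graph \<Rightarrow> 'v \<Rightarrow> 'v \<Rightarrow> bool" where
  "adjacent G u v \<longleftrightarrow> u \<noteq> v \<and> {u, v} \<in> edges G"

definition looped :: "'v graph \<Rightarrow> 'v \<Rightarrow> bool" where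
  "looped G v \<longleftrightarrow> {v} \<in> edges G"

definition remove_verts :: "'v graph \<Rightarrow> 'v set \<Rightarrow> 'v graph" where
  "remove_verts G W = \<lparr>verts = verts G - W, edges = {e \<in> edges G. e \<inter> W = {}}\<rparr>"

definition induced_subgraph :: "'v graph \<Rightarrow> 'v set \<Rightarrow> 'v graph" where
  "induced_subgraph G W = \<lparr>verts = verts G \<inter> W, edges = {e \<in> edges G. e \<subseteq> W}\<rparr>"

text \<open>The first two moves are stated in the removing direction; the equivalence closure taken in
  \<open>reidemeister_equiv\<close> supplies the adjoining direction.\<close>

definition Omega1 :: "'v graph \<Rightarrow> 'v graph \<Rightarrow> bool" where
  "Omega1 G H \<longleftrightarrow>
     (\<exists>v\<in>verts G. (\<forall>x\<in>verts G. \<not> adjacent G v x) \<and> H = remove_verts G {v})"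

definition Omega2 :: "'v graph \<Rightarrow> 'v graph \<Rightarrow> bool" where
  "Omega2 G H \<longleftrightarrow>
     (\<exists>v\<in>verts G. \<exists>w\<in>verts G. looped G v \<and> \<not> looped G w \<and>
        (\<forall>x\<in>verts G - {v, w}. adjacent G x v \<longleftrightarrow> adjacent G x w) \<and>
        H = remove_verts G {v, w})"

definition Omega3_subgraphs :: "nat graph set" where
  "Omega3_subgraphs =
     {\<lparr>verts = {0, 1, 2}, edges = {{0, 1}, {1, 2}, {0}, {1}, {2}}\<rparr>,
      \<lparr>verts = {0, 1, 2}, edges = {{0, 1}, {1, 2}}\<rparr>,
      \<lparr>verts = {0, 1, 2}, edges = {{0, 1}, {1, 2}, {0}, {1}}\<rparr>,
      \<lparr>verts = {0, 1, 2}, edges = {{0, 1}, {1, 2}, {0}}\<rparr>,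
      \<lparr>verts = {0, 1, 2}, edges = {{0, 1}, {1, 2}, {0, 2}, {0}, {1}}\<rparr>,
      \<lparr>verts = {0, 1, 2}, edges = {{0, 1}, {1, 2}, {0, 2}, {0}}\<rparr>}"

definition Omega3 :: "'v graph \<Rightarrow> 'v graph \<Rightarrow> bool" where
  "Omega3 G H \<longleftrightarrow>
     (\<exists>u\<in>verts G. \<exists>v\<in>verts G. \<exists>w\<in>verts G. u \<noteq> v \<and> v \<noteq> w \<and> u \<noteq> w \<and>
        (\<forall>x\<in>verts G - {u, v, w}.
           (\<exists>y\<in>{u, v, w}. adjacent G x y) \<longrightarrow> card {y \<in> {u, v, w}. adjacent G x y} = 2) \<and>
        H = \<lparr>verts = verts G,
             edges = (edges G - {{u, v}, {v, w}, {u, w}}) \<union> ({{u, v}, {v, w}, {u, w}} - edges G)\<rparr> \<and>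
        (\<exists>K\<in>Omega3_subgraphs.
           graph_iso (induced_subgraph G {u, v, w}) K \<or> graph_iso (induced_subgraph H {u, v, w}) K))"

text \<open>Since graphs are taken up to isomorphism, isomorphism is one of the generating steps.\<close>

definition reidemeister_step :: "'v graph \<Rightarrow> 'v graph \<Rightarrow> bool" where
  "reidemeister_step G H \<longleftrightarrow>
     finite_graph G \<and> finite_graph H \<and> (graph_iso G H \<or> Omega1 G H \<or> Omega2 G H \<or> Omega3 G H)"

definition reidemeister_equiv :: "'v graph \<Rightarrow> 'v graph \<Rightarrow> bool" where
  "reidemeister_equiv = equivclp reidemeister_step"


section \<open>Knot diagrams\<close>

text \<open>A diagram is a generic closed curve of period 1 in the plane. The set \<open>over\<close>
  consists of the parameters at which the curve passes over a classical crossing; \<open>virtual\<close>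
  is the set of virtual crossing points.\<close>

record diagram =
  curve :: "real \<Rightarrow> complex"
  over :: "real set"
  virtual :: "complex set"

definition crossings :: "diagram \<Rightarrow> complex set" where
  "crossings D = {p. \<exists>s t. s - t \<notin> \<int> \<and> curve D s = p \<and> curve D t = p}"

definition classical_crossings :: "diagram \<Rightarrow> complex set" where
  "classical_crossings D = crossings D - virtual D"

abbreviation tangent :: "diagram \<Rightarrow> real \<Rightarrow> complex" where
  "tangent D t \<equiv> vector_derivative (curve D) (at t)"

text \<open>The determinant of a pair of plane vectors, positive for a positively oriented basis.\<close>

definition det2 :: "complex \<Rightarrow> complex \<Rightarrow> real" where
  "det2 z w = Re z * Im w - Im z * Re w"

definition knot_diagram :: "diagram \<Rightarrow> bool" where
  "knot_diagram D \<longleftrightarrow>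
     (\<forall>t. curve D (t + 1) = curve D t) \<and>
     curve D C1_differentiable_on UNIV \<and>
     (\<forall>t. tangent D t \<noteq> 0) \<and>
     finite (crossings D) \<and>
     (\<forall>r s t. curve D r = curve D s \<and> curve D s = curve D t \<longrightarrow>
        r - s \<in> \<int> \<or> s - t \<in> \<int> \<or> r - t \<in> \<int>) \<and>
     (\<forall>s t. curve D s = curve D t \<and> s - t \<notin> \<int> \<longrightarrow> det2 (tangent D s) (tangent D t) \<noteq> 0) \<and>
     virtual D \<subseteq> crossings D \<and>
     (\<forall>t. t \<in> over D \<longrightarrow> curve D t \<in> classical_crossings D) \<and>
     (\<forall>t. t + 1 \<in> over D \<longleftrightarrow> t \<in> over D) \<and>
     (\<forall>s t. curve D s = curve D t \<and> s - t \<notin> \<int> \<and> curve D s \<notin> virtual D \<longrightarrow>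
        (s \<in> over D \<longleftrightarrow> t \<notin> over D))"

text \<open>A crossing is negative if the tangents of the overpassing and the underpassing strand, in this
  order, form a negatively oriented basis.\<close>

definition negative_crossing :: "diagram \<Rightarrow> complex \<Rightarrow> bool" where
  "negative_crossing D p \<longleftrightarrow>
     p \<in> classical_crossings D \<and>
     (\<exists>s t. curve D s = p \<and> curve D t = p \<and> s \<in> over D \<and> t \<notin> over D \<and>
        det2 (tangent D s) (tangent D t) < 0)"

definition interlaced :: "diagram \<Rightarrow> complex \<Rightarrow> complex \<Rightarrow> bool" where
  "interlaced D p q \<longleftrightarrow> p \<noteq> q \<and>
     (\<exists>s t s' t'. s < t \<and> t < s' \<and> s' < t' \<and> t' < s + 1 \<and>
        curve D s = p \<and> curve D t = q \<and> curve D s' = p \<and> curve D t' = q)"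

definition looped_interlacement_graph :: "diagram \<Rightarrow> complex graph" where
  "looped_interlacement_graph D =
     \<lparr>verts = classical_crossings D,
      edges = {{p, q} | p q. p \<in> classical_crossings D \<and> q \<in> classical_crossings D \<and>
                             interlaced D p q}
            \<union> {{p} | p. p \<in> classical_crossings D \<and> negative_crossing D p}\<rparr>"


section \<open>Reparametrization and planar isotopy\<close>

text \<open>Diagrams are unoriented and have no base point: the parameter may be changed by any
  diffeomorphism of the circle \<open>\<real>/\<int>\<close>, given by its lift \<open>\<rho>\<close> to the line.\<close>

definition reparametrization :: "diagram \<Rightarrow> diagram \<Rightarrow> bool" where
  "reparametrization D D' \<longleftrightarrow>
     (\<exists>\<rho>. \<exists>\<epsilon>\<in>{1, -1}.
        \<rho> C1_differentiable_on UNIV \<and> (\<forall>t. vector_derivative \<rho> (at t) \<noteq> 0) \<and>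
        (\<forall>t. \<rho> (t + 1) = \<rho> t + \<epsilon>) \<and>
        D' = \<lparr>curve = curve D \<circ> \<rho>, over = \<rho> -` over D, virtual = virtual D\<rparr>)"

definition jacobian :: "(complex \<Rightarrow> complex) \<Rightarrow> complex \<Rightarrow> real" where
  "jacobian \<phi> z = det2 (frechet_derivative \<phi> (at z) 1) (frechet_derivative \<phi> (at z) \<i>)"

text \<open>The inverse is continuously differentiable by the inverse function theorem.\<close>

definition plane_diffeo :: "(complex \<Rightarrow> complex) \<Rightarrow> bool" where
  "plane_diffeo \<phi> \<longleftrightarrow>
     bij \<phi> \<and> (\<forall>z. \<phi> differentiable (at z)) \<and>
     (\<forall>v. continuous_on UNIV (\<lambda>z. frechet_derivative \<phi> (at z) v)) \<and>
     (\<forall>z. jacobian \<phi> z \<noteq> 0)"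

definition planar_isotopy :: "diagram \<Rightarrow> diagram \<Rightarrow> bool" where
  "planar_isotopy D D' \<longleftrightarrow>
     (\<exists>H :: real \<Rightarrow> complex \<Rightarrow> complex.
        H 0 = id \<and> (\<forall>\<tau>\<in>{0..1}. plane_diffeo (H \<tau>)) \<and>
        continuous_on ({0..1} \<times> UNIV) (\<lambda>(\<tau>, z). H \<tau> z) \<and>
        (\<forall>v. continuous_on ({0..1} \<times> UNIV) (\<lambda>(\<tau>, z). frechet_derivative (H \<tau>) (at z) v)) \<and>
        D' = \<lparr>curve = H 1 \<circ> curve D, over = over D, virtual = H 1 ` virtual D\<rparr>)"


section \<open>Replacing tangles\<close>

text \<open>A tangle is a list of arcs in the square \<open>model_square\<close>, parametrized by \<open>[-1, 1]\<close>.
  The pair \<open>(i, s)\<close> in \<open>tangle_over\<close> says that the arc \<open>i\<close> passes over a classical crossing at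
  the parameter \<open>s\<close>.\<close>

record tangle =
  strands :: "(real \<Rightarrow> complex) list"
  tangle_over :: "(nat \<times> real) set"
  tangle_virtual :: "complex set"

definition model_square :: "complex set" where
  "model_square = cbox (Complex (-1) (-1)) (Complex 1 1)"

text \<open>The part of \<open>D\<close> in the disc \<open>\<phi> ` model_square\<close> is the image of the tangle \<open>T\<close>; the arc
  \<open>i\<close> is traversed by \<open>D\<close> on the parameter interval with centre \<open>c i\<close> and radius \<open>\<bar>r i\<bar>\<close>,
  backwards if \<open>r i < 0\<close>. The second condition says that these intervals are disjoint in
  \<open>\<real>/\<int>\<close>.\<close>

definition contains_tangle ::
  "(complex \<Rightarrow> complex) \<Rightarrow> (nat \<Rightarrow> real) \<Rightarrow> (nat \<Rightarrow> real) \<Rightarrow> tangle \<Rightarrow> diagram \<Rightarrow> bool" where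
  "contains_tangle \<phi> c r T D \<longleftrightarrow>
     (let n = length (strands T) in
      (\<forall>i<n. r i \<noteq> 0) \<and>
      (\<forall>i<n. \<forall>j<n. \<forall>s\<in>{-1..1}. \<forall>t\<in>{-1..1}.
         (c i + r i * s) - (c j + r j * t) \<in> \<int> \<longrightarrow> i = j \<and> s = t) \<and>
      (\<forall>i<n. \<forall>s\<in>{-1..1}. curve D (c i + r i * s) = \<phi> ((strands T ! i) s)) \<and>
      (\<forall>t. curve D t \<in> \<phi> ` model_square \<longrightarrow>
         (\<exists>i<n. \<exists>s\<in>{-1..1}. t - (c i + r i * s) \<in> \<int>)) \<and>
      (\<forall>i<n. \<forall>s\<in>{-1..1}. c i + r i * s \<in> over D \<longleftrightarrow> (i, s) \<in> tangle_over T) \<and>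
      virtual D \<inter> \<phi> ` model_square = \<phi> ` tangle_virtual T)"

text \<open>The diagrams agree outside an embedded disc, inside which \<open>T\<close> is replaced by \<open>T'\<close>. The
  chart preserves orientation, so that pictures are not reflected.\<close>

definition tangle_replacement :: "tangle \<Rightarrow> tangle \<Rightarrow> diagram \<Rightarrow> diagram \<Rightarrow> bool" where
  "tangle_replacement T T' D D' \<longleftrightarrow>
     (\<exists>\<phi> c r. plane_diffeo \<phi> \<and> (\<forall>z. jacobian \<phi> z > 0) \<and>
        contains_tangle \<phi> c r T D \<and> contains_tangle \<phi> c r T' D' \<and>
        (\<forall>t. curve D t \<notin> \<phi> ` model_square \<longrightarrow>
           curve D' t = curve D t \<and> (t \<in> over D' \<longleftrightarrow> t \<in> over D)) \<and>
        virtual D' - \<phi> ` model_square = virtual D - \<phi> ` model_square)"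


section \<open>The moves\<close>

text \<open>Each move is a set of pairs of tangles. The arcs before and after a move have the same end
  points and the same velocities there, so that the replacement of one by the other preserves
  continuous differentiability.

  The arc \<open>kink_arc\<close> has a single double point, reached at the parameters \<open>-1/2\<close> and
  \<open>1/2\<close>. The mirror image of the kink in the horizontal axis is the rotated kink traversed
  backwards, so it needs no separate move.\<close>

definition axis_arc :: "real \<Rightarrow> complex" where
  "axis_arc s = Complex s 0"

definition kink_arc :: "real \<Rightarrow> complex" where
  "kink_arc s = Complex (s * (4 * s^2 - 1) * (7 - 4 * s^2) / 9) ((1 - s^2)^2)"

definition kink :: "(nat \<times> real) set \<Rightarrow> complex set \<Rightarrow> tangle" where
  "kink P V = \<lparr>strands = [kink_arc], tangle_over = P, tangle_virtual = V\<rparr>"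

definition no_kink :: tangle where
  "no_kink = \<lparr>strands = [axis_arc], tangle_over = {}, tangle_virtual = {}\<rparr>"

definition R1_moves :: "(tangle \<times> tangle) set" where
  "R1_moves = {(no_kink, kink {(0, -1/2)} {}), (no_kink, kink {(0, 1/2)} {})}"

definition virtual_R1_moves :: "(tangle \<times> tangle) set" where
  "virtual_R1_moves = {(no_kink, kink {} {kink_arc (1/2)})}"

text \<open>For the other moves the crossings are those between different arcs, and \<open>R i j\<close> means that
  the arc \<open>i\<close> passes over the arc \<open>j\<close> at their crossings. If neither passes over the other then
  their crossings are virtual.\<close>

definition tangle_of ::
  "(real \<Rightarrow> complex) list \<Rightarrow> (nat \<Rightarrow> nat \<Rightarrow> bool) \<Rightarrow> tangle" where
  "tangle_of as R =
     \<lparr>strands = as,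
      tangle_over = {(i, s). i < length as \<and> s \<in> {-1..1} \<and>
        (\<exists>j<length as. \<exists>t\<in>{-1..1}. i \<noteq> j \<and> (as ! i) s = (as ! j) t \<and> R i j)},
      tangle_virtual = {z. \<exists>i<length as. \<exists>j<length as. \<exists>s\<in>{-1..1}. \<exists>t\<in>{-1..1}.
        i \<noteq> j \<and> (as ! i) s = z \<and> (as ! j) t = z \<and> \<not> R i j \<and> \<not> R j i}\<rparr>"

text \<open>The arc \<open>dip_arc\<close> meets the horizontal axis at the parameters \<open>-1/2\<close> and \<open>1/2\<close>.\<close>

definition high_arc :: "real \<Rightarrow> complex" where
  "high_arc s = Complex s (9/16)"

definition dip_arc :: "real \<Rightarrow> complex" where
  "dip_arc s = Complex s (9/16 - (1 - s^2)^2)"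

definition R2_pair :: "(nat \<Rightarrow> nat \<Rightarrow> bool) \<Rightarrow> tangle \<times> tangle" where
  "R2_pair R = (tangle_of [high_arc, axis_arc] R, tangle_of [dip_arc, axis_arc] R)"

definition R2_moves :: "(tangle \<times> tangle) set" where
  "R2_moves = {R2_pair (<), R2_pair (>)}"

definition virtual_R2_moves :: "(tangle \<times> tangle) set" where
  "virtual_R2_moves = {R2_pair (\<lambda>i j. False)}"

text \<open>The arc \<open>upper_arc\<close> meets the segments \<open>rising_arc\<close> and \<open>falling_arc\<close> at the
  parameters \<open>1/2\<close> and \<open>-1/2\<close>, and \<open>lower_arc\<close> meets them at \<open>-1/2\<close> and \<open>1/2\<close>. The move
  pushes the arc 0 across the crossing of the arcs 1 and 2.\<close>

definition upper_arc :: "real \<Rightarrow> complex" where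
  "upper_arc s = Complex s ((1 - s^2)^2 / 2)"

definition lower_arc :: "real \<Rightarrow> complex" where
  "lower_arc s = Complex s (- ((1 - s^2)^2 / 2))"

definition rising_arc :: "real \<Rightarrow> complex" where
  "rising_arc s = Complex s (9/16 * s)"

definition falling_arc :: "real \<Rightarrow> complex" where
  "falling_arc s = Complex s (- (9/16 * s))"

definition R3_pair :: "(nat \<Rightarrow> nat \<Rightarrow> bool) \<Rightarrow> tangle \<times> tangle" where
  "R3_pair R = (tangle_of [upper_arc, rising_arc, falling_arc] R,
                tangle_of [lower_arc, rising_arc, falling_arc] R)"

text \<open>In the classical move the three arcs lie at three different heights.\<close>

definition R3_moves :: "(tangle \<times> tangle) set" where
  "R3_moves = {R3_pair (\<lambda>i j. h i > h j) | h :: nat \<Rightarrow> nat. inj_on h {0, 1, 2}}"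

definition virtual_R3_moves :: "(tangle \<times> tangle) set" where
  "virtual_R3_moves = {R3_pair (\<lambda>i j. False)}"

definition mixed_moves :: "(tangle \<times> tangle) set" where
  "mixed_moves = {R3_pair (\<lambda>i j. i = 1 \<and> j = 2), R3_pair (\<lambda>i j. i = 2 \<and> j = 1)}"

definition classical_moves :: "(tangle \<times> tangle) set" where
  "classical_moves = R1_moves \<union> R2_moves \<union> R3_moves"

definition virtual_moves :: "(tangle \<times> tangle) set" where
  "virtual_moves =
     classical_moves \<union> virtual_R1_moves \<union> virtual_R2_moves \<union> virtual_R3_moves \<union> mixed_moves"


section \<open>Diagrams of the same knot\<close>

definition diagram_step :: "(tangle \<times> tangle) set \<Rightarrow> diagram \<Rightarrow> diagram \<Rightarrow> bool" where
  "diagram_step M D D' \<longleftrightarrow>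
     knot_diagram D \<and> knot_diagram D' \<and>
     (reparametrization D D' \<or> planar_isotopy D D' \<or>
      (\<exists>(T, T')\<in>M. tangle_replacement T T' D D'))"

definition classical_diagram :: "diagram \<Rightarrow> bool" where
  "classical_diagram D \<longleftrightarrow> knot_diagram D \<and> virtual D = {}"

definition same_classical_knot :: "diagram \<Rightarrow> diagram \<Rightarrow> bool" where
  "same_classical_knot D D' \<longleftrightarrow>
     classical_diagram D \<and> classical_diagram D' \<and>
     equivclp (\<lambda>E E'. classical_diagram E \<and> classical_diagram E' \<and>
                       diagram_step classical_moves E E') D D'"

definition same_virtual_knot :: "diagram \<Rightarrow> diagram \<Rightarrow> bool" where
  "same_virtual_knot D D' \<longleftrightarrow>
     knot_diagram D \<and> knot_diagram D' \<and> equivclp (diagram_step virtual_moves) D D'"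

end

theory Submission
  imports Defs
begin

text \<open>Cut the circle of parameters at a point \<open>t0\<close>. Two crossings are chords of the resulting interval,
and chords cross exactly when an odd number of the four comparisons ``end of the first lies before
end of the second'' hold (\<open>interlaced_iff\<close>). Interlacement is thus a sum modulo 2 of comparisons
of parameters, and all of the combinatorics becomes Boolean algebra.

A reparametrization of the circle preserves or reverses the cyclic order, and scales the two
tangents at a crossing by factors of the same sign; it does not change the graph. A planar isotopy
ends in a diffeomorphism of positive Jacobian, which is an isomorphism of the graphs.

In a move, the tangle occupies finitely many disjoint parameter intervals, the arcs. A crossing
outside the disc compares in the same way with all parameters of one arc, so it has a well-defined
side with respect to each arc, given by \<open>odd_before\<close>, and this side is the same before and after
the move. It is adjacent to a crossing of the arcs \<open>i\<close> and \<open>j\<close> if and only if it separates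
these arcs (\<open>interlaced_outside_inside\<close>). Hence the crossing of a kink is isolated; the two
crossings of a second move have the same neighbours outside; and of the three crossings of a third
move an outer vertex is adjacent to none or to exactly two, because three arcs have two sides to lie
on. These are the side conditions of the three moves on graphs.

The loops come from the signs: the chart preserves orientation, so the sign of a crossing is that
of the model crossing, changed once for each of the two arcs that is traversed backwards
(\<open>negative_crossing_in_disc\<close>). The two crossings of a second move therefore have opposite signs.
In a third move the order of the two crossings on each arc is reversed while everything else stays,
so that all three adjacencies are toggled and the loops are kept. It remains to see that the
triple is one of the six listed graphs, up to toggling. This is a finite check over the directions,
the order and the heights of the three arcs (\<open>R3_parity\<close>), in which the heights enter through the
fact that passing over is not cyclic. A virtual crossing contributes no vertex, so the virtual moves
do not change the graph, and in the mixed move the only vertex keeps its arcs and its sign.\<close>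

section \<open>Looped graphs and the third move\<close>

lemma graph_edges_eq:
  assumes "finite_graph G"
  shows "edges G = {{u, v} | u v. u \<in> verts G \<and> v \<in> verts G \<and> adjacent G u v}
                 \<union> {{v} | v. v \<in> verts G \<and> looped G v}"
proof (intro equalityI subsetI)
  fix e assume e: "e \<in> edges G"
  then obtain u v where uv: "u \<in> verts G" "v \<in> verts G" "e = {u, v}"
    using assms by (auto simp: finite_graph_def)
  show "e \<in> {{u, v} | u v. u \<in> verts G \<and> v \<in> verts G \<and> adjacent G u v}
                 \<union> {{v} | v. v \<in> verts G \<and> looped G v}"
  proof (cases "u = v")
    case True
    then show ?thesis using uv e by (auto simp: looped_def)
  next
    case False
    then have "adjacent G u v" using uv e by (auto simp: adjacent_def)
    then show ?thesis using uv by blast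
  qed
qed (auto simp: adjacent_def looped_def)

lemma graph_isoI:
  assumes "finite_graph G" "finite_graph H" and f: "bij_betw f (verts G) (verts H)"
    and adj: "\<And>x y. x \<in> verts G \<Longrightarrow> y \<in> verts G \<Longrightarrow> adjacent H (f x) (f y) \<longleftrightarrow> adjacent G x y"
    and loop: "\<And>x. x \<in> verts G \<Longrightarrow> looped H (f x) \<longleftrightarrow> looped G x"
  shows "graph_iso G H"
  unfolding graph_iso_def
proof (intro exI conjI)
  have V: "verts H = f ` verts G" using f by (simp add: bij_betw_def)
  show "edges H = (\<lambda>e. f ` e) ` edges G"
  proof (intro equalityI subsetI)
    fix e assume "e \<in> edges H"
    then consider (a) x y where "x \<in> verts G" "y \<in> verts G" "adjacent H (f x) (f y)" "e = {f x, f y}"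
      | (l) x where "x \<in> verts G" "looped H (f x)" "e = {f x}"
      using graph_edges_eq[OF assms(2)] V by auto
    then show "e \<in> (\<lambda>e. f ` e) ` edges G"
    proof cases
      case a
      then have "{x, y} \<in> edges G" "e = f ` {x, y}" using adj by (auto simp: adjacent_def)
      then show ?thesis by blast
    next
      case l
      then have "{x} \<in> edges G" "e = f ` {x}" using loop by (auto simp: looped_def)
      then show ?thesis by blast
    qed
  next
    fix e' assume "e' \<in> (\<lambda>e. f ` e) ` edges G"
    then obtain e where e: "e \<in> edges G" "e' = f ` e" by blast
    then consider (a) x y where "x \<in> verts G" "y \<in> verts G" "adjacent G x y" "e = {x, y}"
      | (l) x where "x \<in> verts G" "looped G x" "e = {x}"
      using graph_edges_eq[OF assms(1)] by auto
    then show "e' \<in> edges H"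
    proof cases
      case a
      then have "adjacent H (f x) (f y)" using adj by blast
      then show ?thesis using a e by (simp add: adjacent_def)
    next
      case l
      then have "looped H (f x)" using loop by blast
      then show ?thesis using l e by (simp add: looped_def)
    qed
  qed
qed (fact f)

lemma graph_eqI:
  fixes G H :: "'v graph"
  assumes "finite_graph G" "finite_graph H" "verts G = verts H"
    and "\<And>x y. x \<in> verts G \<Longrightarrow> y \<in> verts G \<Longrightarrow> adjacent G x y \<longleftrightarrow> adjacent H x y"
    and "\<And>x. x \<in> verts G \<Longrightarrow> looped G x \<longleftrightarrow> looped H x"
  shows "G = H"
proof -
  have "edges G = edges H"
    unfolding graph_edges_eq[OF assms(1)] graph_edges_eq[OF assms(2)] using assms(3-5) by auto
  then show ?thesis using assms(3) by simp
qed

lemma adjacent_sym: "adjacent G x y \<longleftrightarrow> adjacent G y x"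
  by (auto simp: adjacent_def insert_commute)

lemma verts_remove_verts [simp]: "verts (remove_verts G W) = verts G - W"
  by (simp add: remove_verts_def)

lemma adjacent_remove_verts:
  "adjacent (remove_verts G W) x y \<longleftrightarrow> adjacent G x y \<and> x \<notin> W \<and> y \<notin> W"
  by (auto simp: remove_verts_def adjacent_def)

lemma looped_remove_verts: "looped (remove_verts G W) x \<longleftrightarrow> looped G x \<and> x \<notin> W"
  by (auto simp: remove_verts_def looped_def)

lemma finite_graph_remove_verts: "finite_graph G \<Longrightarrow> finite_graph (remove_verts G W)"
  unfolding finite_graph_def remove_verts_def by fastforce

lemma finite_graph_induced_subgraph: "finite_graph G \<Longrightarrow> finite_graph (induced_subgraph G W)"
  unfolding finite_graph_def induced_subgraph_def by fastforce

lemma reidemeister_equiv_step: "reidemeister_step G H \<Longrightarrow> reidemeister_equiv G H"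
  unfolding reidemeister_equiv_def by (rule r_into_equivclp)

lemma reidemeister_equiv_sym: "reidemeister_equiv G H \<Longrightarrow> reidemeister_equiv H G"
  unfolding reidemeister_equiv_def by (rule equivclp_sym)

lemma reidemeister_equiv_trans:
  "reidemeister_equiv G H \<Longrightarrow> reidemeister_equiv H K \<Longrightarrow> reidemeister_equiv G K"
  unfolding reidemeister_equiv_def by (rule equivclp_trans)

lemma reidemeister_equiv_refl: "reidemeister_equiv G G"
  unfolding reidemeister_equiv_def by simp

text \<open>Up to toggling, a triple of vertices is a path or a triangle: the graph with one edge toggles to
a path, the graph without edges to the triangle. In terms that do not see the toggling, the six
listed graphs are given by their loops. If one of the vertices has equal adjacencies to the other
two, different from the adjacency between these two, then it must not be the only vertex in its loop
state; if all three adjacencies are equal, the loop states must not all be equal.\<close>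

definition admissible_triple :: "'v graph \<Rightarrow> 'v \<Rightarrow> 'v \<Rightarrow> 'v \<Rightarrow> bool" where
  "admissible_triple G u v w \<longleftrightarrow>
     (if adjacent G u v = adjacent G v w \<and> adjacent G v w = adjacent G u w
      then \<not> (looped G u = looped G v \<and> looped G v = looped G w)
      else if adjacent G u v = adjacent G v w then looped G u = looped G w \<longrightarrow> looped G v = looped G u
      else if adjacent G v w = adjacent G u w then looped G v = looped G u \<longrightarrow> looped G w = looped G v
      else looped G w = looped G v \<longrightarrow> looped G u = looped G w)"

lemma induced_subgraph_iso_triple:
  fixes K :: "nat graph"
  assumes G: "finite_graph G" "u \<in> verts G" "v \<in> verts G" "w \<in> verts G" "u \<noteq> v" "v \<noteq> w" "u \<noteq> w"
    and K: "finite_graph K" "verts K = {0, 1, 2}"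
    and "adjacent K 0 1 \<longleftrightarrow> adjacent G u v" "adjacent K 1 2 \<longleftrightarrow> adjacent G v w"
      "adjacent K 0 2 \<longleftrightarrow> adjacent G u w"
    and "looped K 0 \<longleftrightarrow> looped G u" "looped K 1 \<longleftrightarrow> looped G v" "looped K 2 \<longleftrightarrow> looped G w"
  shows "graph_iso (induced_subgraph G {u, v, w}) K"
proof (rule graph_isoI[where f = "\<lambda>x. if x = u then 0 else if x = v then 1 else 2"])
  have V: "verts (induced_subgraph G {u, v, w}) = {u, v, w}"
    using G by (auto simp: induced_subgraph_def)
  have irr: "\<not> adjacent X y y" for X :: "'c graph" and y by (simp add: adjacent_def)
  have adjI: "adjacent (induced_subgraph G {u, v, w}) x y \<longleftrightarrow> adjacent G x y"
    if "x \<in> {u, v, w}" "y \<in> {u, v, w}" for x y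
    using that by (auto simp: induced_subgraph_def adjacent_def)
  have loopI: "looped (induced_subgraph G {u, v, w}) x \<longleftrightarrow> looped G x" if "x \<in> {u, v, w}" for x
    using that by (auto simp: induced_subgraph_def looped_def)
  show "bij_betw (\<lambda>x. if x = u then 0 else if x = v then 1 else 2)
          (verts (induced_subgraph G {u, v, w})) (verts K)"
    unfolding V K using G by (auto simp: bij_betw_def inj_on_def)
  show "adjacent K (if x = u then 0 else if x = v then 1 else 2)
          (if y = u then 0 else if y = v then 1 else 2) \<longleftrightarrow> adjacent (induced_subgraph G {u, v, w}) x y"
    if "x \<in> verts (induced_subgraph G {u, v, w})" "y \<in> verts (induced_subgraph G {u, v, w})" for x y
    using that assms(5-7,10-12) unfolding V 
    by (simp add: adjI, elim disjE) (simp_all add: irr, simp_all add: adjacent_sym)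
  show "looped K (if x = u then 0 else if x = v then 1 else 2)
          \<longleftrightarrow> looped (induced_subgraph G {u, v, w}) x"
    if "x \<in> verts (induced_subgraph G {u, v, w})" for x
    using that assms(5-7,13-15) unfolding V by (auto simp add: loopI)
qed (use assms finite_graph_induced_subgraph in auto)

lemma graph_simps:
  "adjacent \<lparr>verts = V, edges = E\<rparr> u v \<longleftrightarrow> u \<noteq> v \<and> {u, v} \<in> E"
  "looped \<lparr>verts = V, edges = E\<rparr> u \<longleftrightarrow> {u} \<in> E"
  by (auto simp: adjacent_def looped_def)

lemma path_iso_Omega3_subgraph:
  assumes G: "finite_graph G" "u \<in> verts G" "v \<in> verts G" "w \<in> verts G" "u \<noteq> v" "v \<noteq> w" "u \<noteq> w"
    and "adjacent G u v" "adjacent G v w" "\<not> adjacent G u w"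
    and "looped G u = looped G w \<longrightarrow> looped G v = looped G u" "looped G u \<or> \<not> looped G w"
  shows "\<exists>K\<in>Omega3_subgraphs. graph_iso (induced_subgraph G {u, v, w}) K"
proof -
  let ?V = "{0, 1, 2 :: nat}"
  consider "looped G u" "looped G v" "looped G w" | "\<not> looped G u" "\<not> looped G v" "\<not> looped G w"
    | "looped G u" "looped G v" "\<not> looped G w" | "looped G u" "\<not> looped G v" "\<not> looped G w"
    using assms(11,12) by blast
  then show ?thesis
  proof cases
    case 1
    show ?thesis
      by (rule bexI[where x = "\<lparr>verts = ?V, edges = {{0, 1}, {1, 2}, {0}, {1}, {2}}\<rparr>"],
          rule induced_subgraph_iso_triple)
        (use assms 1 in \<open>auto simp: graph_simps finite_graph_def doubleton_eq_iff Omega3_subgraphs_def\<close>)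
  next
    case 2
    show ?thesis
      by (rule bexI[where x = "\<lparr>verts = ?V, edges = {{0, 1}, {1, 2}}\<rparr>"],
          rule induced_subgraph_iso_triple)
        (use assms 2 in \<open>auto simp: graph_simps finite_graph_def doubleton_eq_iff Omega3_subgraphs_def\<close>)
  next
    case 3
    show ?thesis
      by (rule bexI[where x = "\<lparr>verts = ?V, edges = {{0, 1}, {1, 2}, {0}, {1}}\<rparr>"],
          rule induced_subgraph_iso_triple)
        (use assms 3 in \<open>auto simp: graph_simps finite_graph_def doubleton_eq_iff Omega3_subgraphs_def\<close>)
  next
    case 4
    show ?thesis
      by (rule bexI[where x = "\<lparr>verts = ?V, edges = {{0, 1}, {1, 2}, {0}}\<rparr>"],
          rule induced_subgraph_iso_triple)
        (use assms 4 in \<open>auto simp: graph_simps finite_graph_def doubleton_eq_iff Omega3_subgraphs_def\<close>)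
  qed
qed

lemma triangle_iso_Omega3_subgraph:
  assumes G: "finite_graph G" "u \<in> verts G" "v \<in> verts G" "w \<in> verts G" "u \<noteq> v" "v \<noteq> w" "u \<noteq> w"
    and "adjacent G u v" "adjacent G v w" "adjacent G u w"
    and "looped G u" "\<not> looped G w"
  shows "\<exists>K\<in>Omega3_subgraphs. graph_iso (induced_subgraph G {u, v, w}) K"
proof -
  let ?V = "{0, 1, 2 :: nat}"
  show ?thesis
  proof (cases "looped G v")
    case True
    show ?thesis
      by (rule bexI[where x = "\<lparr>verts = ?V, edges = {{0, 1}, {1, 2}, {0, 2}, {0}, {1}}\<rparr>"],
          rule induced_subgraph_iso_triple)
        (use assms True in \<open>auto simp: graph_simps finite_graph_def doubleton_eq_iff Omega3_subgraphs_def\<close>)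
  next
    case False
    show ?thesis
      by (rule bexI[where x = "\<lparr>verts = ?V, edges = {{0, 1}, {1, 2}, {0, 2}, {0}}\<rparr>"],
          rule induced_subgraph_iso_triple)
        (use assms False in \<open>auto simp: graph_simps finite_graph_def doubleton_eq_iff Omega3_subgraphs_def\<close>)
  qed
qed

text \<open>With at least two edges an admissible triple is itself a path or a triangle. Orienting it so that
the loops are where the list has them leaves one case for each of the six graphs.\<close>

lemma admissible_triple_iso:
  assumes G: "finite_graph G" "u \<in> verts G" "v \<in> verts G" "w \<in> verts G" "u \<noteq> v" "v \<noteq> w" "u \<noteq> w"
    and adm: "admissible_triple G u v w"
    and dense: "adjacent G u v \<and> adjacent G v w \<or> adjacent G v w \<and> adjacent G u w
      \<or> adjacent G u w \<and> adjacent G u v"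
  shows "\<exists>K\<in>Omega3_subgraphs. graph_iso (induced_subgraph G {u, v, w}) K"
proof -
  have path: ?thesis if "{a, b, c} = {u, v, w}" "a \<noteq> b" "b \<noteq> c" "a \<noteq> c"
      "adjacent G a b" "adjacent G b c" "\<not> adjacent G a c"
      "looped G a = looped G c \<longrightarrow> looped G b = looped G a" for a b c
  proof -
    have V: "a \<in> verts G" "b \<in> verts G" "c \<in> verts G" using that(1) G by auto
    have "{c, b, a} = {u, v, w}" using that(1) by auto
    then show ?thesis
      using path_iso_Omega3_subgraph[OF G(1) V that(2-4) that(5-8)]
        path_iso_Omega3_subgraph[of G c b a] that V G(1) by (auto simp: adjacent_sym)
  qed
  have triangle: ?thesis if "{a, b, c} = {u, v, w}" "a \<noteq> b" "b \<noteq> c" "a \<noteq> c"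
      "adjacent G a b" "adjacent G b c" "adjacent G a c" "looped G a" "\<not> looped G c" for a b c
  proof -
    have V: "a \<in> verts G" "b \<in> verts G" "c \<in> verts G" using that(1) G by auto
    then show ?thesis using triangle_iso_Omega3_subgraph[OF G(1) V that(2-9)] that(1) by simp
  qed
  show ?thesis
  proof (cases "adjacent G u v \<and> adjacent G v w \<and> adjacent G u w")
    case True
    have adj: "adjacent G u v" "adjacent G v w" "adjacent G u w"
      "adjacent G v u" "adjacent G w v" "adjacent G w u"
      using True by (simp_all add: adjacent_sym)
    have "\<not> (looped G u = looped G v \<and> looped G v = looped G w)"
      using adm True by (simp add: admissible_triple_def)
    then consider "looped G u" "\<not> looped G w" | "looped G w" "\<not> looped G u" | "looped G u" "\<not> looped G v" | "looped G v" "\<not> looped G u" | "looped G v" "\<not> looped G w" | "looped G w" "\<not> looped G v"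
      by blast
    then show ?thesis
    proof cases
      case 1
      show ?thesis by (rule triangle[of u v w]) (use adj G(5-7) 1 in auto)
    next
      case 2
      show ?thesis by (rule triangle[of w v u]) (use adj G(5-7) 2 in auto)
    next
      case 3
      show ?thesis by (rule triangle[of u w v]) (use adj G(5-7) 3 in auto)
    next
      case 4
      show ?thesis by (rule triangle[of v w u]) (use adj G(5-7) 4 in auto)
    next
      case 5
      show ?thesis by (rule triangle[of v u w]) (use adj G(5-7) 5 in auto)
    next
      case 6
      show ?thesis by (rule triangle[of w u v]) (use adj G(5-7) 6 in auto)
    qed
  next
    case False
    have sym: "adjacent G v u \<longleftrightarrow> adjacent G u v" "adjacent G w v \<longleftrightarrow> adjacent G v w"
      "adjacent G w u \<longleftrightarrow> adjacent G u w"
      by (simp_all add: adjacent_sym)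
    consider "adjacent G u v" "adjacent G v w" "\<not> adjacent G u w"
      | "adjacent G v w" "\<not> adjacent G u v" "adjacent G u w"
      | "adjacent G u v" "\<not> adjacent G v w" "adjacent G u w"
      using dense False by blast
    then show ?thesis
    proof cases
      case 1
      show ?thesis
        by (rule path[of u v w]) (use 1 adm G(5-7) sym in \<open>auto simp: admissible_triple_def\<close>)
    next
      case 2
      show ?thesis
        by (rule path[of v w u]) (use 2 adm G(5-7) sym in \<open>auto simp: admissible_triple_def\<close>)
    next
      case 3
      show ?thesis
        by (rule path[of v u w]) (use 3 adm G(5-7) sym in \<open>auto simp: admissible_triple_def\<close>)
    qed
  qed
qed

definition toggle_triple :: "'v graph \<Rightarrow> 'v \<Rightarrow> 'v \<Rightarrow> 'v \<Rightarrow> 'v graph" where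
  "toggle_triple G u v w = \<lparr>verts = verts G,
     edges = (edges G - {{u, v}, {v, w}, {u, w}}) \<union> ({{u, v}, {v, w}, {u, w}} - edges G)\<rparr>"

lemma adjacent_toggle_triple:
  assumes "u \<noteq> v" "v \<noteq> w" "u \<noteq> w"
  shows "adjacent (toggle_triple G u v w) x y \<longleftrightarrow>
    x \<noteq> y \<and> (adjacent G x y \<noteq> ({x, y} \<subseteq> {u, v, w}))"
proof (cases "x = y")
  case False
  then have "{x, y} \<in> {{u, v}, {v, w}, {u, w}} \<longleftrightarrow> {x, y} \<subseteq> {u, v, w}"
    using assms by (auto simp: doubleton_eq_iff)
  moreover have "e \<in> (A - B) \<union> (B - A) \<longleftrightarrow> (e \<in> A) \<noteq> (e \<in> B)" for e :: "'a set" and A B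
    by auto
  ultimately have "{x, y} \<in> edges (toggle_triple G u v w) \<longleftrightarrow>
      ({x, y} \<in> edges G) \<noteq> ({x, y} \<subseteq> {u, v, w})"
    by (simp only: toggle_triple_def graph.simps)
  with False show ?thesis by (simp only: adjacent_def) simp
qed (simp add: adjacent_def)

lemma looped_toggle_triple:
  assumes "u \<noteq> v" "v \<noteq> w" "u \<noteq> w"
  shows "looped (toggle_triple G u v w) x \<longleftrightarrow> looped G x"
proof -
  have "{x} \<notin> {{u, v}, {v, w}, {u, w}}" using assms by auto
  then show ?thesis unfolding toggle_triple_def looped_def by auto
qed

lemma finite_graph_toggle_triple:
  assumes "finite_graph G" "u \<in> verts G" "v \<in> verts G" "w \<in> verts G"
  shows "finite_graph (toggle_triple G u v w)"
  unfolding finite_graph_def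
proof (intro conjI ballI)
  fix e assume "e \<in> edges (toggle_triple G u v w)"
  then have "e \<in> edges G \<or> e = {u, v} \<or> e = {v, w} \<or> e = {u, w}"
    by (auto simp: toggle_triple_def)
  then show "\<exists>a\<in>verts (toggle_triple G u v w). \<exists>b\<in>verts (toggle_triple G u v w). e = {a, b}"
    using assms by (auto simp: finite_graph_def toggle_triple_def)
qed (use assms in \<open>simp add: finite_graph_def toggle_triple_def\<close>)

lemma admissible_triple_toggle:
  assumes "u \<noteq> v" "v \<noteq> w" "u \<noteq> w"
  shows "admissible_triple (toggle_triple G u v w) u v w \<longleftrightarrow> admissible_triple G u v w"
proof -
  have "adjacent (toggle_triple G u v w) u v \<longleftrightarrow> \<not> adjacent G u v"
    "adjacent (toggle_triple G u v w) v w \<longleftrightarrow> \<not> adjacent G v w"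
    "adjacent (toggle_triple G u v w) u w \<longleftrightarrow> \<not> adjacent G u w"
    using assms by (simp_all add: adjacent_toggle_triple)
  then show ?thesis
    unfolding admissible_triple_def looped_toggle_triple[OF assms]
    by (cases "adjacent G u v"; cases "adjacent G v w"; cases "adjacent G u w") simp_all
qed

text \<open>Either the triple or its toggled version has at least two edges, so one of the two is in the list;
both are admissible by \<open>admissible_triple_toggle\<close>.\<close>

lemma Omega3_toggle_triple:
  assumes G: "finite_graph G" "u \<in> verts G" "v \<in> verts G" "w \<in> verts G" and ne: "u \<noteq> v" "v \<noteq> w" "u \<noteq> w"
    and adm: "admissible_triple G u v w"
    and even: "\<And>x. x \<in> verts G - {u, v, w} \<Longrightarrow> adjacent G x u = (adjacent G x v \<noteq> adjacent G x w)"
  shows "Omega3 G (toggle_triple G u v w)"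
proof -
  let ?H = "toggle_triple G u v w"
  have two: "card {y \<in> {u, v, w}. adjacent G x y} = 2"
    if x: "x \<in> verts G - {u, v, w}" "\<exists>y\<in>{u, v, w}. adjacent G x y" for x
  proof -
    consider "adjacent G x u" "adjacent G x v" "\<not> adjacent G x w"
      | "adjacent G x u" "\<not> adjacent G x v" "adjacent G x w"
      | "\<not> adjacent G x u" "adjacent G x v" "adjacent G x w"
      using even[OF x(1)] x(2) by auto
    then show ?thesis
    proof cases
      case 1 then have "{y \<in> {u, v, w}. adjacent G x y} = {u, v}" by auto
      then show ?thesis using ne by simp
    next
      case 2 then have "{y \<in> {u, v, w}. adjacent G x y} = {u, w}" by auto
      then show ?thesis using ne by simp
    next
      case 3 then have "{y \<in> {u, v, w}. adjacent G x y} = {v, w}" by auto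
      then show ?thesis using ne by simp
    qed
  qed
  have V: "verts ?H = verts G" by (simp add: toggle_triple_def)
  have "\<exists>K\<in>Omega3_subgraphs. graph_iso (induced_subgraph G {u, v, w}) K
      \<or> graph_iso (induced_subgraph ?H {u, v, w}) K"
  proof (cases "adjacent G u v \<and> adjacent G v w \<or> adjacent G v w \<and> adjacent G u w
      \<or> adjacent G u w \<and> adjacent G u v")
    case True
    then show ?thesis using admissible_triple_iso[OF G ne adm] by blast
  next
    case False
    then have "adjacent ?H u v \<and> adjacent ?H v w \<or> adjacent ?H v w \<and> adjacent ?H u w
      \<or> adjacent ?H u w \<and> adjacent ?H u v"
      using ne by (auto simp: adjacent_toggle_triple)
    then show ?thesis
      using admissible_triple_iso[of ?H u v w] finite_graph_toggle_triple[OF G] G ne adm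
      by (auto simp: V admissible_triple_toggle)
  qed
  moreover have "\<forall>x\<in>verts G - {u, v, w}. (\<exists>y\<in>{u, v, w}. adjacent G x y) \<longrightarrow>
      card {y \<in> {u, v, w}. adjacent G x y} = 2"
    using two by blast
  ultimately show ?thesis
    unfolding Omega3_def toggle_triple_def
    by (intro bexI[OF _ G(2)] bexI[OF _ G(3)] bexI[OF _ G(4)] conjI ne refl)
qed

text \<open>The vertices are points of the plane, and a third move on diagrams displaces its crossings.
Therefore the toggled graph is compared with \<open>H\<close> by an isomorphism that is the identity only on
the set \<open>C\<close> of the crossings away from the move.\<close>

lemma Omega3_equivI:
  assumes fin: "finite_graph G" "finite_graph H"
    and VG: "verts G = insert u (insert v (insert w C))"
    and VH: "verts H = insert u' (insert v' (insert w' C))"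
    and ne: "u \<noteq> v" "v \<noteq> w" "u \<noteq> w" "u \<notin> C" "v \<notin> C" "w \<notin> C"
    and ne': "u' \<noteq> v'" "v' \<noteq> w'" "u' \<noteq> w'" "u' \<notin> C" "v' \<notin> C" "w' \<notin> C"
    and outer: "\<And>x y. x \<in> C \<Longrightarrow> y \<in> C \<Longrightarrow> adjacent G x y \<longleftrightarrow> adjacent H x y"
      "\<And>x. x \<in> C \<Longrightarrow> looped G x \<longleftrightarrow> looped H x"
    and mixed: "\<And>x. x \<in> C \<Longrightarrow> adjacent G x u \<longleftrightarrow> adjacent H x u'"
      "\<And>x. x \<in> C \<Longrightarrow> adjacent G x v \<longleftrightarrow> adjacent H x v'"
      "\<And>x. x \<in> C \<Longrightarrow> adjacent G x w \<longleftrightarrow> adjacent H x w'"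
    and even: "\<And>x. x \<in> C \<Longrightarrow> adjacent G x u = (adjacent G x v \<noteq> adjacent G x w)"
    and inner: "adjacent H u' v' \<longleftrightarrow> \<not> adjacent G u v" "adjacent H v' w' \<longleftrightarrow> \<not> adjacent G v w"
      "adjacent H u' w' \<longleftrightarrow> \<not> adjacent G u w"
      "looped H u' \<longleftrightarrow> looped G u" "looped H v' \<longleftrightarrow> looped G v" "looped H w' \<longleftrightarrow> looped G w"
    and adm: "admissible_triple G u v w"
  shows "reidemeister_equiv G H"
proof -
  let ?K = "toggle_triple G u v w"
  let ?f = "\<lambda>x. if x = u then u' else if x = v then v' else if x = w then w' else x"
  have K: "finite_graph ?K" using fin VG by (intro finite_graph_toggle_triple) auto
  have "Omega3 G ?K" using assms by (intro Omega3_toggle_triple) auto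
  then have 1: "reidemeister_equiv G ?K"
    using fin(1) K by (intro reidemeister_equiv_step) (simp add: reidemeister_step_def)
  have VK: "verts ?K = insert u (insert v (insert w C))" using VG by (simp add: toggle_triple_def)
  have irr: "\<not> adjacent X y y" for X :: "'a graph" and y by (simp add: adjacent_def)
  have "graph_iso ?K H"
  proof (rule graph_isoI[where f = ?f])
    show "bij_betw ?f (verts ?K) (verts H)"
      unfolding VK VH bij_betw_def inj_on_def using ne ne' by auto
    show "looped H (?f x) \<longleftrightarrow> looped ?K x" if "x \<in> verts ?K" for x
      using that ne outer inner unfolding VK by (auto simp: looped_toggle_triple)
    show "adjacent H (?f x) (?f y) \<longleftrightarrow> adjacent ?K x y" if "x \<in> verts ?K" "y \<in> verts ?K" for x y
    proof -
      have "x = u \<or> x = v \<or> x = w \<or> x \<in> C" "y = u \<or> y = v \<or> y = w \<or> y \<in> C"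
        using that VK by auto
      moreover have s: "adjacent X a b \<longleftrightarrow> adjacent X b a" for X :: "'a graph" and a b
        by (rule adjacent_sym)
      note [simp] = s[of H v' u'] s[of H w' v'] s[of H w' u'] s[of G v u] s[of G w v] s[of G w u]
      have [simp]: "a \<noteq> u" "a \<noteq> v" "a \<noteq> w" "adjacent H u' a \<longleftrightarrow> adjacent G a u"
        "adjacent H v' a \<longleftrightarrow> adjacent G a v" "adjacent H w' a \<longleftrightarrow> adjacent G a w"
        "adjacent G u a \<longleftrightarrow> adjacent G a u" "adjacent G v a \<longleftrightarrow> adjacent G a v"
        "adjacent G w a \<longleftrightarrow> adjacent G a w" if "a \<in> C" for a
        using that ne mixed by (auto simp: s[of H _ a] s[of G _ a])
      ultimately show ?thesis
        using ne ne(1-3)[symmetric]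
        by (elim disjE) (simp_all add: adjacent_toggle_triple irr inner mixed[symmetric] outer[symmetric], 
             auto simp: irr)
    qed
  qed (use fin K in auto)
  then have 2: "reidemeister_equiv ?K H"
    using fin(2) K by (intro reidemeister_equiv_step) (simp add: reidemeister_step_def)
  show ?thesis by (rule reidemeister_equiv_trans[OF 1 2])
qed

section \<open>Interlacement graphs under reparametrization and isotopy\<close>

lemma shift_by_int:
  fixes f :: "real \<Rightarrow> 'a"
  assumes "\<And>t. f (t + 1) = f t"
  shows "f (t + of_int m) = f t"
proof -
  have *: "f (t + real n) = f t" for n t
  proof (induction n)
    case (Suc n)
    have "f (t + real (Suc n)) = f ((t + real n) + 1)" by (simp add: algebra_simps)
    then show ?case using Suc assms by simp
  qed simp
  show ?thesis
  proof (cases "m \<ge> 0")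
    case True
    then show ?thesis using *[of t "nat m"] by simp
  next
    case False
    then show ?thesis using *[of "t + of_int m" "nat (- m)"] by simp
  qed
qed

lemma curve_eq_mod_int:
  assumes "knot_diagram D" "s - t \<in> \<int>"
  shows "curve D s = curve D t"
proof -
  obtain m where "s - t = of_int m" using assms(2) Ints_cases by blast
  then show ?thesis
    using shift_by_int[of "curve D" t m] assms(1) by (simp add: knot_diagram_def algebra_simps)
qed

lemma over_eq_mod_int:
  assumes "knot_diagram D" "s - t \<in> \<int>"
  shows "s \<in> over D \<longleftrightarrow> t \<in> over D"
proof -
  obtain m where "s - t = of_int m" using assms(2) Ints_cases by blast
  then show ?thesis
    using shift_by_int[of "\<lambda>t. t \<in> over D" t m] assms(1)
    by (simp add: knot_diagram_def algebra_simps)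
qed

lemma curve_has_tangent:
  assumes "knot_diagram D"
  shows "(curve D has_vector_derivative tangent D t) (at t)"
  using assms by (simp add: knot_diagram_def C1_differentiable_on_eq vector_derivative_works)

lemma tangent_eq_mod_int:
  assumes "knot_diagram D" "s - t \<in> \<int>"
  shows "tangent D s = tangent D t"
proof -
  have "curve D \<circ> (\<lambda>x. x + (s - t)) = curve D"
    using curve_eq_mod_int[OF assms(1)] assms(2) by auto
  moreover have "((\<lambda>x. x + (s - t)) has_vector_derivative 1) (at t)"
    by (auto intro!: derivative_eq_intros)
  from vector_diff_chain_at[OF this, of "curve D" "tangent D s"]
  have "(curve D \<circ> (\<lambda>x. x + (s - t)) has_vector_derivative tangent D s) (at t)"
    using curve_has_tangent[OF assms(1), of s] by simp
  ultimately show ?thesis by (simp add: vector_derivative_at)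
qed

text \<open>Start the cyclic tour at the second crossing instead of the first.\<close>

lemma interlaced_sym:
  assumes "knot_diagram D"
  shows "interlaced D p q \<longleftrightarrow> interlaced D q p"
proof -
  have "interlaced D q p" if "interlaced D p q" for p q
  proof -
    obtain s t s' t' where *: "s < t" "t < s'" "s' < t'" "t' < s + 1" "p \<noteq> q"
      "curve D s = p" "curve D t = q" "curve D s' = p" "curve D t' = q"
      using \<open>interlaced D p q\<close> by (auto simp: interlaced_def)
    then have "curve D (s + 1) = p" using assms by (simp add: knot_diagram_def)
    then show ?thesis unfolding interlaced_def
      using * by (intro conjI exI[of _ t] exI[of _ s'] exI[of _ t'] exI[of _ "s + 1"]) auto
  qed
  then show ?thesis by blast
qed

lemma verts_interlacement [simp]:
  "verts (looped_interlacement_graph D) = classical_crossings D"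
  by (simp add: looped_interlacement_graph_def)

lemma adjacent_interlacement:
  assumes "knot_diagram D"
  shows "adjacent (looped_interlacement_graph D) p q \<longleftrightarrow>
    p \<in> classical_crossings D \<and> q \<in> classical_crossings D \<and> interlaced D p q"
proof -
  have "p \<noteq> q" if "interlaced D p q" using that by (simp add: interlaced_def)
  then show ?thesis
    unfolding adjacent_def looped_interlacement_graph_def
    using interlaced_sym[OF assms] by (auto simp: doubleton_eq_iff)
qed

lemma looped_interlacement:
  "looped (looped_interlacement_graph D) p \<longleftrightarrow> negative_crossing D p"
  unfolding looped_def looped_interlacement_graph_def
  by (auto simp: negative_crossing_def interlaced_def)

lemma finite_interlacement:
  "knot_diagram D \<Longrightarrow> finite_graph (looped_interlacement_graph D)"
  unfolding finite_graph_def looped_interlacement_graph_def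
  by (fastforce simp: knot_diagram_def classical_crossings_def)

lemma det2_scaleR: "det2 (a *\<^sub>R v) (b *\<^sub>R w) = a * b * det2 v w"
  by (simp add: det2_def algebra_simps)

text \<open>A linear map of the plane multiplies all areas by its determinant.\<close>

lemma det2_linear:
  assumes "linear A"
  shows "det2 (A v) (A w) = det2 (A 1) (A \<i>) * det2 v w"
proof -
  have "A z = Re z *\<^sub>R A 1 + Im z *\<^sub>R A \<i>" for z
  proof -
    have "A z = A (Re z *\<^sub>R 1 + Im z *\<^sub>R \<i>)"
      by (rule arg_cong[of _ _ A]) (simp add: complex_eq_iff)
    then show ?thesis using assms by (simp add: linear_add linear_scale)
  qed
  from this[of v] this[of w] show ?thesis
    by (simp add: det2_def algebra_simps)
qed

text \<open>A map reversing the order shows the two crossings alternating from the other end, that is, starting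
with \<open>q\<close>. One direction is enough: the inverse of a reparametrization satisfies the same
assumptions.\<close>

lemma reparametrization_interlaced:
  assumes D: "knot_diagram D" and D': "curve D' = curve D \<circ> \<rho>"
    and \<rho>: "\<And>t. \<rho> (t + 1) = \<rho> t + \<epsilon>"
    and mono: "\<epsilon> = 1 \<and> strict_mono \<rho> \<or> \<epsilon> = -1 \<and> (\<forall>x y. x < y \<longrightarrow> \<rho> y < \<rho> x)"
    and "interlaced D' p q"
  shows "interlaced D p q"
proof -
  obtain s t s' t' where *: "s < t" "t < s'" "s' < t'" "t' < s + 1" "p \<noteq> q"
    "curve D (\<rho> s) = p" "curve D (\<rho> t) = q" "curve D (\<rho> s') = p" "curve D (\<rho> t') = q"
    using \<open>interlaced D' p q\<close> by (auto simp: interlaced_def D')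
  from mono show ?thesis
  proof (elim disjE conjE)
    assume m: "\<epsilon> = 1" "strict_mono \<rho>"
    then have "\<rho> s < \<rho> t" "\<rho> t < \<rho> s'" "\<rho> s' < \<rho> t'" "\<rho> t' < \<rho> (s + 1)"
      using * by (auto simp: strict_mono_def)
    then show ?thesis using * m \<rho> unfolding interlaced_def
      by (intro conjI exI[of _ "\<rho> s"] exI[of _ "\<rho> t"] exI[of _ "\<rho> s'"] exI[of _ "\<rho> t'"]) auto
  next
    assume m: "\<epsilon> = -1" "(\<forall>x y. x < y \<longrightarrow> \<rho> y < \<rho> x)"
    then have "\<rho> s > \<rho> t" "\<rho> t > \<rho> s'" "\<rho> s' > \<rho> t'" "\<rho> t' > \<rho> (s + 1)"
      using * by auto
    then have "interlaced D q p" using * m \<rho> unfolding interlaced_def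
      by (intro conjI exI[of _ "\<rho> t'"] exI[of _ "\<rho> s'"] exI[of _ "\<rho> t"] exI[of _ "\<rho> s"]) auto
    then show ?thesis using interlaced_sym[OF D] by blast
  qed
qed

text \<open>The derivative is continuous without zeros, hence of constant sign, and this sign decides which of
the two values \<open>\<epsilon>\<close> takes.\<close>

lemma reparametrization_monotone:
  assumes C1: "\<rho> C1_differentiable_on UNIV" and ne: "\<And>t. vector_derivative \<rho> (at t) \<noteq> 0"
    and per: "\<And>t. \<rho> (t + 1) = \<rho> t + \<epsilon>"  and \<epsilon>: "\<epsilon> \<in> {1, - 1 :: real}"
  obtains "\<epsilon> = 1" "strict_mono \<rho>" "\<And>t. vector_derivative \<rho> (at t) > 0"
    | "\<epsilon> = -1" "(\<forall>x y. x < y \<longrightarrow> \<rho> y < \<rho> x)" "\<And>t. vector_derivative \<rho> (at t) < 0"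
proof -
  let ?d = "\<lambda>t. vector_derivative \<rho> (at t)"
  have der: "DERIV \<rho> t :> ?d t" for t
    using C1 by (simp add: C1_differentiable_on_eq vector_derivative_works
        has_real_derivative_iff_has_vector_derivative)
  have "connected (range ?d)"
    using C1 by (intro connected_continuous_image) (auto simp: C1_differentiable_on_eq)
  then have "(\<forall>t. ?d t > 0) \<or> (\<forall>t. ?d t < 0)"
    using ne connectedD_interval[of "range ?d" "?d _" "?d _" 0]
    by (metis (no_types, lifting) linorder_less_linear order.strict_implies_order rangeE rangeI)
  then show ?thesis
  proof
    assume pos: "\<forall>t. ?d t > 0"
    have m: "strict_mono \<rho>"
      unfolding strict_mono_def using der pos by (metis DERIV_pos_imp_increasing)
    then have "\<rho> 0 < \<rho> (0 + 1)" by (simp add: strict_mono_def)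
    then have "\<epsilon> = 1" using per[of 0] \<epsilon> by auto
    then show ?thesis using that(1) m pos by blast
  next
    assume neg: "\<forall>t. ?d t < 0"
    have m: "(\<forall>x y. x < y \<longrightarrow> \<rho> y < \<rho> x)"
      using der neg by (metis DERIV_neg_imp_decreasing)
    then have "\<rho> 0 > \<rho> (0 + 1)" by simp
    then have "\<epsilon> = -1" using per[of 0] \<epsilon> by auto
    then show ?thesis using that(2) m neg by blast
  qed
qed

text \<open>A crossing keeps its place in the plane and its two passages. At these the tangents are multiplied by
two values of the derivative of \<open>\<rho>\<close>, which have the same sign, so that the sign of the crossing
does not change even if the curve is traversed backwards.\<close>

lemma reparametrization_interlacement_eq:
  assumes D: "knot_diagram D" and D': "knot_diagram D'" and "reparametrization D D'"
  shows "looped_interlacement_graph D = looped_interlacement_graph D'"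
proof -
  obtain \<rho> \<epsilon> where \<epsilon>: "\<epsilon> \<in> {1, -1}" and C1: "\<rho> C1_differentiable_on UNIV"
    and ne: "\<And>t. vector_derivative \<rho> (at t) \<noteq> 0" and per: "\<And>t. \<rho> (t + 1) = \<rho> t + \<epsilon>"
    and D'_eq: "D' = \<lparr>curve = curve D \<circ> \<rho>, over = \<rho> -` over D, virtual = virtual D\<rparr>"
    using assms(3) unfolding reparametrization_def by blast
  have mono: "\<epsilon> = 1 \<and> strict_mono \<rho> \<or> \<epsilon> = -1 \<and> (\<forall>x y. x < y \<longrightarrow> \<rho> y < \<rho> x)"
    and same_sign: "vector_derivative \<rho> (at s) * vector_derivative \<rho> (at t) > 0" for s t
    using reparametrization_monotone[OF C1 ne per \<epsilon>] by (metis, metis mult_neg_neg mult_pos_pos)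
  have inj: "inj \<rho>"
    using mono by (auto simp: strict_mono_def inj_def) (metis less_irrefl linorder_cases)+
  have per_int: "\<rho> (t + of_int m) = \<rho> t + \<epsilon> * of_int m" for t m
    using shift_by_int[of "\<lambda>t. \<rho> t - \<epsilon> * t" t m] per by (simp add: algebra_simps)
  have \<epsilon>\<epsilon>: "\<epsilon> * (\<epsilon> * x) = x" for x using \<epsilon> by auto
  have cont: "continuous_on UNIV \<rho>"
    using C1 C1_differentiable_imp_continuous_on by blast
  have surj: "surj \<rho>"
  proof -
    have "\<exists>x. y = \<rho> x" for y
    proof -
      obtain n where n: "\<bar>y - \<rho> 0\<bar> \<le> of_int n" by (meson ex_le_of_int)
      have "connected (range \<rho>)" by (rule connected_continuous_image[OF cont connected_UNIV])
      moreover have "\<rho> 0 + of_int m \<in> range \<rho>" for m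
      proof -
        obtain e :: int where "\<epsilon> = of_int e" using \<epsilon> by (auto intro: that[of 1] that[of "-1"])
        then have "\<rho> (0 + of_int (e * m)) = \<rho> 0 + of_int m"
          unfolding per_int unfolding of_int_mult by (metis \<epsilon>\<epsilon>)
        then show ?thesis by (metis rangeI)
      qed
      from this[of n] this[of "- n"] have "\<rho> 0 + of_int n \<in> range \<rho>" "\<rho> 0 + of_int (- n) \<in> range \<rho>" .
      ultimately have "y \<in> range \<rho>"
        using n connectedD_interval[of "range \<rho>" "\<rho> 0 + of_int (- n)" "\<rho> 0 + of_int n" y] by auto
      then show ?thesis by blast
    qed
    then show ?thesis by (simp add: surj_def)
  qed
  define \<sigma> where "\<sigma> = inv \<rho>"
  have \<rho>\<sigma> [simp]: "\<rho> (\<sigma> y) = y" for y using surj by (simp add: \<sigma>_def surj_f_inv_f)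
  have \<sigma>\<rho> [simp]: "\<sigma> (\<rho> x) = x" for x using inj by (simp add: \<sigma>_def)
  have mono\<sigma>: "\<epsilon> = 1 \<and> strict_mono \<sigma> \<or> \<epsilon> = -1 \<and> (\<forall>x y. x < y \<longrightarrow> \<sigma> y < \<sigma> x)"
  proof -
    have "strict_mono \<sigma>" if "strict_mono \<rho>"
      using that by (metis \<rho>\<sigma> strict_mono_def strict_mono_less)
    moreover have "(\<forall>x y. x < y \<longrightarrow> \<sigma> y < \<sigma> x)" if "(\<forall>x y. x < y \<longrightarrow> \<rho> y < \<rho> x)"
    proof (intro allI impI)
      fix x y :: real assume "x < y"
      then have "\<rho> (\<sigma> x) < \<rho> (\<sigma> y)" by simp
      then show "\<sigma> x > \<sigma> y"
        using that by (metis less_asym less_irrefl linorder_cases)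
    qed
    ultimately show ?thesis using mono by blast
  qed
  have per\<sigma>: "\<sigma> (t + 1) = \<sigma> t + \<epsilon>" for t
  proof -
    obtain e :: int where "\<epsilon> = of_int e" using \<epsilon> by (auto intro: that[of 1] that[of "-1"])
    then have "\<rho> (\<sigma> t + \<epsilon>) = t + 1" using per_int[of "\<sigma> t" e] \<epsilon>\<epsilon>[of 1] by simp
    then show ?thesis by (metis \<sigma>\<rho>)
  qed
  have ints: "\<rho> s - \<rho> t \<in> \<int> \<longleftrightarrow> s - t \<in> \<int>" for s t
  proof
    assume "s - t \<in> \<int>"
    then obtain m where "s = t + of_int m" by (metis Ints_cases add.commute diff_add_cancel)
    then have "\<rho> s - \<rho> t = \<epsilon> * of_int m" using per_int by simp
    then show "\<rho> s - \<rho> t \<in> \<int>" using \<epsilon> by auto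
  next
    assume "\<rho> s - \<rho> t \<in> \<int>"
    then obtain m where m: "\<rho> s = \<rho> t + of_int m" by (metis Ints_cases add.commute diff_add_cancel)
    obtain e :: int where e: "\<epsilon> = of_int e" using \<epsilon> by (auto intro: that[of 1] that[of "-1"])
    have "\<rho> (t + of_int (e * m)) = \<rho> s" unfolding per_int m unfolding of_int_mult by (metis \<epsilon>\<epsilon> e)
    then have "s = t + of_int (e * m)" using inj by (simp add: inj_def)
    then show "s - t \<in> \<int>" by simp
  qed
  have "crossings D' = crossings D"
    unfolding crossings_def D'_eq by (auto, metis \<rho>\<sigma> ints, metis \<rho>\<sigma> ints)
  then have V: "classical_crossings D' = classical_crossings D"
    by (simp add: classical_crossings_def D'_eq)
  have tangent': "tangent D' t = vector_derivative \<rho> (at t) *\<^sub>R tangent D (\<rho> t)" for t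
  proof -
    have "(\<rho> has_vector_derivative vector_derivative \<rho> (at t)) (at t)"
      using C1 by (simp add: C1_differentiable_on_eq vector_derivative_works)
    from vector_diff_chain_at[OF this curve_has_tangent[OF D]] show ?thesis
      by (simp add: D'_eq vector_derivative_at)
  qed
  have det': "det2 (tangent D' s) (tangent D' t) < 0 \<longleftrightarrow>
      det2 (tangent D (\<rho> s)) (tangent D (\<rho> t)) < 0" for s t
    unfolding tangent' det2_scaleR by (metis mult_less_cancel_left_pos mult_zero_right same_sign)
  have neg: "negative_crossing D' p \<longleftrightarrow> negative_crossing D p" for p
  proof -
    have "(\<exists>s t. curve D' s = p \<and> curve D' t = p \<and> s \<in> over D' \<and> t \<notin> over D' \<and>
        det2 (tangent D' s) (tangent D' t) < 0) \<longleftrightarrow>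
      (\<exists>s t. curve D (\<rho> s) = p \<and> curve D (\<rho> t) = p \<and> \<rho> s \<in> over D \<and> \<rho> t \<notin> over D \<and>
        det2 (tangent D (\<rho> s)) (tangent D (\<rho> t)) < 0)"
      unfolding det' by (simp add: D'_eq)
    also have "\<dots> \<longleftrightarrow> (\<exists>s t. curve D s = p \<and> curve D t = p \<and> s \<in> over D \<and> t \<notin> over D \<and>
        det2 (tangent D s) (tangent D t) < 0)"
      by (metis \<rho>\<sigma>)
    finally show ?thesis by (simp add: negative_crossing_def V)
  qed
  have inter: "interlaced D' p q \<longleftrightarrow> interlaced D p q" for p q
  proof
    show "interlaced D p q" if "interlaced D' p q"
      by (rule reparametrization_interlaced[OF D _ per mono that]) (simp add: D'_eq)
    show "interlaced D' p q" if "interlaced D p q"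
      by (rule reparametrization_interlaced[OF D' _ per\<sigma> mono\<sigma> that]) (auto simp: D'_eq)
  qed
  show ?thesis
    by (rule graph_eqI) (use D D' in \<open>simp_all add: finite_interlacement V neg inter
          adjacent_interlacement looped_interlacement\<close>)
qed

lemma plane_diffeo_has_derivative:
  "plane_diffeo \<phi> \<Longrightarrow> (\<phi> has_derivative frechet_derivative \<phi> (at z)) (at z)"
  by (simp add: plane_diffeo_def frechet_derivative_works)

lemma plane_diffeo_inj: "plane_diffeo \<phi> \<Longrightarrow> \<phi> z = \<phi> w \<longleftrightarrow> z = w"
  by (auto simp: plane_diffeo_def bij_def inj_eq)

lemma det2_frechet:
  assumes "plane_diffeo \<phi>"
  shows "det2 (frechet_derivative \<phi> (at z) v) (frechet_derivative \<phi> (at z) w)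
    = jacobian \<phi> z * det2 v w"
  unfolding jacobian_def
  by (rule det2_linear) (rule has_derivative_linear[OF plane_diffeo_has_derivative[OF assms]])

lemma has_vector_derivative_plane_diffeo:
  assumes "plane_diffeo \<phi>" "(\<gamma> has_vector_derivative v) (at t)"
  shows "((\<lambda>t. \<phi> (\<gamma> t)) has_vector_derivative frechet_derivative \<phi> (at (\<gamma> t)) v) (at t)"
proof -
  have d: "(\<phi> has_derivative frechet_derivative \<phi> (at (\<gamma> t))) (at (\<gamma> t))"
    by (rule plane_diffeo_has_derivative[OF assms(1)])
  from diff_chain_at[OF assms(2)[unfolded has_vector_derivative_def] d]
  show ?thesis
    unfolding has_vector_derivative_def
    using linear_scale[OF has_derivative_linear[OF d]] by (simp add: o_def)
qed

text \<open>Along the isotopy the Jacobian at a fixed point is continuous, equals 1 at the start and never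
vanishes, so at the end it is positive. This keeps the signs of the crossings; interlacement is kept since
the final map is injective.\<close>

lemma planar_isotopy_interlacement_iso:
  assumes D: "knot_diagram D" and D': "knot_diagram D'" and "planar_isotopy D D'"
  shows "graph_iso (looped_interlacement_graph D) (looped_interlacement_graph D')"
proof -
  obtain H :: "real \<Rightarrow> complex \<Rightarrow> complex" where H0: "H 0 = id"
    and Hd: "\<And>\<tau>. \<tau> \<in> {0..1} \<Longrightarrow> plane_diffeo (H \<tau>)"
    and Hc: "\<And>v. continuous_on ({0..1} \<times> UNIV) (\<lambda>(\<tau>, z). frechet_derivative (H \<tau>) (at z) v)"
    and D'_eq: "D' = \<lparr>curve = H 1 \<circ> curve D, over = over D, virtual = H 1 ` virtual D\<rparr>"
    using assms(3) unfolding planar_isotopy_def by blast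
  define \<phi> where "\<phi> = H 1"
  have \<phi>: "plane_diffeo \<phi>" using Hd by (simp add: \<phi>_def)
  note inj = plane_diffeo_inj[OF \<phi>]
  have jac: "jacobian \<phi> z > 0" for z
  proof -
    have fc: "continuous_on {0..1} (\<lambda>\<tau>. frechet_derivative (H \<tau>) (at z) v)" for v
    proof -
      have "continuous_on {0..1} (\<lambda>\<tau>. (\<tau>, z))" by (intro continuous_intros)
      from continuous_on_compose2[OF Hc this, of v] show ?thesis by auto
    qed
    have "continuous_on {0..1} (\<lambda>\<tau>. jacobian (H \<tau>) z)"
      unfolding jacobian_def det2_def by (intro continuous_intros fc)
    then have "connected ((\<lambda>\<tau>. jacobian (H \<tau>) z) ` {0..1})"
      by (rule connected_continuous_image) simp
    moreover have "jacobian (H 0) z = 1"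
      by (simp add: H0 jacobian_def det2_def frechet_derivative_id id_def)
    ultimately have "0 \<in> (\<lambda>\<tau>. jacobian (H \<tau>) z) ` {0..1}" if "jacobian (H 1) z \<le> 0"
      using connectedD_interval[of "(\<lambda>\<tau>. jacobian (H \<tau>) z) ` {0..1}" "jacobian (H 1) z"
          "jacobian (H 0) z" 0] that by auto
    moreover have "jacobian (H \<tau>) z \<noteq> 0" if "\<tau> \<in> {0..1}" for \<tau>
      using Hd[OF that] by (simp add: plane_diffeo_def)
    ultimately show ?thesis unfolding \<phi>_def by force
  qed
  have curve': "curve D' t = \<phi> (curve D t)" for t by (simp add: D'_eq \<phi>_def)
  have "crossings D' = \<phi> ` crossings D"
    unfolding crossings_def curve' using inj by force
  then have V: "classical_crossings D' = \<phi> ` classical_crossings D"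
    using inj by (auto simp: classical_crossings_def D'_eq \<phi>_def[symmetric])
  have tangent': "tangent D' t = frechet_derivative \<phi> (at (curve D t)) (tangent D t)" for t
    using has_vector_derivative_plane_diffeo[OF \<phi> curve_has_tangent[OF D, of t]]
    by (simp add: curve'[symmetric] vector_derivative_at)
  have neg: "negative_crossing D' (\<phi> p) \<longleftrightarrow> negative_crossing D p" for p
  proof -
    have "det2 (tangent D' s) (tangent D' t) < 0 \<longleftrightarrow> det2 (tangent D s) (tangent D t) < 0"
      if "curve D s = curve D t" for s t
      unfolding tangent' that det2_frechet[OF \<phi>] using jac[of "curve D t"]
      by (simp add: mult_less_0_iff)
    then have "(\<exists>s t. curve D s = p \<and> curve D t = p \<and> s \<in> over D \<and> t \<notin> over D \<and>
        det2 (tangent D' s) (tangent D' t) < 0) \<longleftrightarrow>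
      (\<exists>s t. curve D s = p \<and> curve D t = p \<and> s \<in> over D \<and> t \<notin> over D \<and>
        det2 (tangent D s) (tangent D t) < 0)"
      by metis
    moreover have "over D' = over D" by (simp add: D'_eq)
    moreover have "\<phi> p \<in> \<phi> ` A \<longleftrightarrow> p \<in> A" for A using inj by auto
    ultimately show ?thesis unfolding negative_crossing_def V curve' inj by simp
  qed
  have inter: "interlaced D' (\<phi> p) (\<phi> q) \<longleftrightarrow> interlaced D p q" for p q
    unfolding interlaced_def curve' inj ..
  show ?thesis
    by (rule graph_isoI[where f = \<phi>])
      (use D D' inj in \<open>auto simp: finite_interlacement V neg inter adjacent_interlacement
          looped_interlacement bij_betw_def inj_on_def\<close>)
qed

section \<open>Interlacement as a parity\<close>

lemma eq_in_period:
  fixes x y t0 :: real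
  assumes "x \<in> {t0..<t0 + 1}" "y \<in> {t0..<t0 + 1}" "x - y \<in> \<int>"
  shows "x = y"
proof -
  obtain m where m: "x - y = of_int m" using assms(3) Ints_cases by blast
  then have "\<bar>of_int m :: real\<bar> < 1" using assms by auto
  then have "m = 0" by linarith
  then show ?thesis using m by simp
qed

lemma shift_into_period:
  fixes x t0 :: real
  obtains m where "x - of_int m \<in> {t0..<t0 + 1}"
proof
  show "x - of_int \<lfloor>x - t0\<rfloor> \<in> {t0..<t0 + 1}" by simp linarith
qed

lemma crossing_preimages:
  assumes D: "knot_diagram D" and p: "p \<in> crossings D"
  obtains a b where "a \<in> {t0..<t0 + 1}" "b \<in> {t0..<t0 + 1}" "a \<noteq> b" "curve D a = p" "curve D b = p"
proof -
  obtain s t where st: "s - t \<notin> \<int>" "curve D s = p" "curve D t = p"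
    using p by (auto simp: crossings_def)
  obtain m n where mn: "s - of_int m \<in> {t0..<t0 + 1}" "t - of_int n \<in> {t0..<t0 + 1}"
    using shift_into_period by metis
  have "s - of_int m \<noteq> t - of_int n"
  proof
    assume "s - of_int m = t - of_int n"
    then have "s - t = of_int (m - n)" by simp
    then show False using st(1) by (metis Ints_of_int)
  qed
  moreover have "curve D (s - of_int m) = curve D s" "curve D (t - of_int n) = curve D t"
    by (rule curve_eq_mod_int[OF D], simp)+
  ultimately show ?thesis using that[OF mn] st by simp
qed

text \<open>Because a diagram has no triple points, two parameters of a crossing in one period are all of them.\<close>

lemma preimage_in_period:
  assumes D: "knot_diagram D" and "a \<in> {t0..<t0 + 1}" "b \<in> {t0..<t0 + 1}" "a \<noteq> b"
    "curve D a = p" "curve D b = p"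
  shows "x \<in> {t0..<t0 + 1} \<and> curve D x = p \<longleftrightarrow> x = a \<or> x = b"
proof -
  have "x - a \<in> \<int> \<or> a - b \<in> \<int> \<or> x - b \<in> \<int>" if "curve D x = p"
    using D that assms(5,6) unfolding knot_diagram_def by metis
  then show ?thesis using eq_in_period[of _ t0] assms by metis
qed

text \<open>The pairs \<open>{a, b}\<close> and \<open>{c, d}\<close> are chords of the circle cut at \<open>t0\<close>, and the right hand side
says that exactly one of \<open>c\<close> and \<open>d\<close> lies between \<open>a\<close> and \<open>b\<close>. Written as a sum of four
comparisons modulo 2, the condition is symmetric in each pair, so it is independent of which passage comes first.\<close>

lemma interlaced_iff:
  assumes D: "knot_diagram D"
    and ab: "a \<in> {t0..<t0 + 1}" "b \<in> {t0..<t0 + 1}" "a \<noteq> b" "curve D a = p" "curve D b = p"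
    and cd: "c \<in> {t0..<t0 + 1}" "d \<in> {t0..<t0 + 1}" "c \<noteq> d" "curve D c = q" "curve D d = q"
    and pq: "p \<noteq> q"
  shows "interlaced D p q \<longleftrightarrow> ((a < c) \<noteq> (b < c)) \<noteq> ((a < d) \<noteq> (b < d))"
proof
  assume "interlaced D p q"
  then obtain s t s' t' where *: "s < t" "t < s'" "s' < t'" "t' < s + 1"
    "curve D s = p" "curve D t = q" "curve D s' = p" "curve D t' = q"
    by (auto simp: interlaced_def)
  (* Moving the four parameters of the tour back into the period rotates their cyclic order:
     some final part of the tour wraps around the cut. *)
  define rep where "rep x = x - of_int \<lfloor>x - t0\<rfloor>" for x
  define m where "m = \<lfloor>s - t0\<rfloor>"
  have rep: "rep x \<in> {t0..<t0 + 1}" "curve D (rep x) = curve D x" for x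
  proof -
    show "rep x \<in> {t0..<t0 + 1}" unfolding rep_def by simp linarith
    show "curve D (rep x) = curve D x" unfolding rep_def by (rule curve_eq_mod_int[OF D]) simp
  qed
  have rs: "rep s = s - of_int m" by (simp add: rep_def m_def)
  have next_period: "rep x = x - of_int m \<or> rep x = x - of_int m - 1" if "s \<le> x" "x < s + 1" for x
  proof -
    have "m \<le> \<lfloor>x - t0\<rfloor>" "\<lfloor>x - t0\<rfloor> \<le> m + 1" using that unfolding m_def by linarith+
    then have "\<lfloor>x - t0\<rfloor> = m \<or> \<lfloor>x - t0\<rfloor> = m + 1" by linarith
    then show ?thesis by (auto simp: rep_def)
  qed
  have s': "rep s' = s' - of_int m \<or> rep s' = s' - of_int m - 1"
    and t: "rep t = t - of_int m \<or> rep t = t - of_int m - 1"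
    and t': "rep t' = t' - of_int m \<or> rep t' = t' - of_int m - 1"
    using * by (intro next_period; simp)+
  note bounds = rep(1)[of s, unfolded atLeastLessThan_iff] rep(1)[of s', unfolded atLeastLessThan_iff]
    rep(1)[of t, unfolded atLeastLessThan_iff] rep(1)[of t', unfolded atLeastLessThan_iff]
  have "rep s < rep t \<and> rep t < rep s' \<and> rep s' < rep t' \<or> rep t' < rep s \<and> rep s < rep t \<and> rep t < rep s'
    \<or> rep s' < rep t' \<and> rep t' < rep s \<and> rep s < rep t \<or> rep t < rep s' \<and> rep s' < rep t' \<and> rep t' < rep s"
    using s' t t' rs bounds *(1-4) by (smt (verit))
  then have main: "((rep s < rep t) \<noteq> (rep s' < rep t)) \<noteq> ((rep s < rep t') \<noteq> (rep s' < rep t'))"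
    "rep s \<noteq> rep s'" "rep t \<noteq> rep t'"
    by auto
  have "rep s = a \<or> rep s = b" "rep s' = a \<or> rep s' = b"
    using preimage_in_period[OF D ab] rep *(5-8) by metis+
  moreover have "rep t = c \<or> rep t = d" "rep t' = c \<or> rep t' = d"
    using preimage_in_period[OF D cd] rep *(5-8) by metis+
  ultimately show "((a < c) \<noteq> (b < c)) \<noteq> ((a < d) \<noteq> (b < d))"
    using main by (elim disjE; simp; blast)
next
  assume x: "((a < c) \<noteq> (b < c)) \<noteq> ((a < d) \<noteq> (b < d))"
  have I: "interlaced D p q"
    if "s < t" "t < s'" "s' < t'" "t' < s + 1" "curve D s = p" "curve D t = q" "curve D s' = p" "curve D t' = q"
    for s t s' t'
    unfolding interlaced_def using that pq by blast
  have J: "interlaced D p q"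
    if "t < s" "s < t'" "t' < s'" "s' < t + 1" "curve D s = p" "curve D t = q" "curve D s' = p" "curve D t' = q"
    for s t s' t'
  proof -
    have "interlaced D q p" unfolding interlaced_def using that pq by blast
    then show ?thesis using interlaced_sym[OF D] by blast
  qed
  have ne: "a \<noteq> c" "a \<noteq> d" "b \<noteq> c" "b \<noteq> d" using ab cd pq by auto
  consider "a < c" "\<not> b < c" "a < d" "b < d"
    | "a < c" "\<not> b < c" "\<not> a < d" "\<not> b < d"
    | "\<not> a < c" "b < c" "a < d" "b < d"
    | "\<not> a < c" "b < c" "\<not> a < d" "\<not> b < d"
    | "a < c" "b < c" "a < d" "\<not> b < d"
    | "\<not> a < c" "\<not> b < c" "a < d" "\<not> b < d"
    | "a < c" "b < c" "\<not> a < d" "b < d"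
    | "\<not> a < c" "\<not> b < c" "\<not> a < d" "b < d"
    using x by blast
  then show "interlaced D p q"
  proof cases
    case 1
    then show ?thesis using I[of a c b d] ne ab cd by auto
  next
    case 2
    then show ?thesis using J[of d a c b] ne ab cd by auto
  next
    case 3
    then show ?thesis using I[of b c a d] ne ab cd by auto
  next
    case 4
    then show ?thesis using J[of d b c a] ne ab cd by auto
  next
    case 5
    then show ?thesis using I[of a d b c] ne ab cd by auto
  next
    case 6
    then show ?thesis using J[of c a d b] ne ab cd by auto
  next
    case 7
    then show ?thesis using I[of b d a c] ne ab cd by auto
  next
    case 8
    then show ?thesis using J[of c b d a] ne ab cd by auto
  qed
qed

text \<open>The side of the chord \<open>p\<close> on which the parameter \<open>x\<close> lies. It is constant as \<open>x\<close> runs along an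
arc that avoids \<open>p\<close>, and it only depends on the passages of the curve through \<open>p\<close>.\<close>

definition odd_before :: "diagram \<Rightarrow> real \<Rightarrow> complex \<Rightarrow> real \<Rightarrow> bool" where
  "odd_before D t0 p x \<longleftrightarrow> odd (card {a \<in> {t0..<t0 + 1}. curve D a = p \<and> a < x})"

lemma odd_before_iff:
  assumes "knot_diagram D" and "a \<in> {t0..<t0 + 1}" "b \<in> {t0..<t0 + 1}" "a \<noteq> b"
    "curve D a = p" "curve D b = p"
  shows "odd_before D t0 p x \<longleftrightarrow> (a < x) \<noteq> (b < x)"
proof -
  have "{y \<in> {t0..<t0 + 1}. curve D y = p \<and> y < x} = {y \<in> {a, b}. y < x}"
    using preimage_in_period[OF assms] by blast
  moreover have "{y \<in> {a, b}. y < x} = (if a < x then {a} else {}) \<union> (if b < x then {b} else {})"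
    by auto
  ultimately show ?thesis using assms(4) by (simp add: odd_before_def)
qed

text \<open>A double point of the model tangle, with the two passages through it. The passages may belong to the
same arc, as in a kink.\<close>

definition tangle_meets :: "tangle \<Rightarrow> nat \<Rightarrow> real \<Rightarrow> nat \<Rightarrow> real \<Rightarrow> bool" where
  "tangle_meets T i s j t \<longleftrightarrow> i < length (strands T) \<and> j < length (strands T) \<and>
     s \<in> {-1..1} \<and> t \<in> {-1..1} \<and> (i, s) \<noteq> (j, t) \<and> (strands T ! i) s = (strands T ! j) t"

definition tangle_crossings :: "tangle \<Rightarrow> complex set" where
  "tangle_crossings T = {(strands T ! i) s | i s j t. tangle_meets T i s j t} - tangle_virtual T"

section \<open>A diagram that contains a tangle\<close>

text \<open>The circle is cut at a point \<open>t0\<close> such that no arc runs across the cut. Then the arcs are disjoint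
intervals of the real line, and comparing parameters on different arcs amounts to comparing the
centres of the arcs.\<close>

locale tangle_in_diagram =
  fixes D :: diagram and \<phi> :: "complex \<Rightarrow> complex" and c r :: "nat \<Rightarrow> real"
    and T :: tangle and t0 :: real
  assumes diagram: "knot_diagram D"
    and diffeo: "plane_diffeo \<phi>" and jacobian_pos: "\<And>z. jacobian \<phi> z > 0"
    and tangle: "contains_tangle \<phi> c r T D"
    and arcs_in_period: "\<And>i. i < length (strands T) \<Longrightarrow> t0 \<le> c i - \<bar>r i\<bar> \<and> c i + \<bar>r i\<bar> < t0 + 1"
    and strands_in_square:
      "\<And>i s. i < length (strands T) \<Longrightarrow> s \<in> {-1..1} \<Longrightarrow> (strands T ! i) s \<in> model_square"
begin

abbreviation arcs :: nat where "arcs \<equiv> length (strands T)"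
abbreviation disc :: "complex set" where "disc \<equiv> \<phi> ` model_square"
abbreviation par :: "nat \<Rightarrow> real \<Rightarrow> real" where "par i s \<equiv> c i + r i * s"

lemmas phi_eq_iff [simp] = plane_diffeo_inj[OF diffeo]

lemmas tangle_clauses = tangle[unfolded contains_tangle_def Let_def]

lemma r_nonzero: "i < arcs \<Longrightarrow> r i \<noteq> 0"
  using tangle_clauses[THEN conjunct1] by blast

lemma par_eq_mod_int:
  "i < arcs \<Longrightarrow> j < arcs \<Longrightarrow> s \<in> {-1..1} \<Longrightarrow> t \<in> {-1..1} \<Longrightarrow>
    par i s - par j t \<in> \<int> \<Longrightarrow> i = j \<and> s = t"
  using tangle_clauses[THEN conjunct2, THEN conjunct1] by blast

lemma curve_par: "i < arcs \<Longrightarrow> s \<in> {-1..1} \<Longrightarrow> curve D (par i s) = \<phi> ((strands T ! i) s)"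
  using tangle_clauses[THEN conjunct2, THEN conjunct2, THEN conjunct1] by blast

lemma in_disc_par: "curve D x \<in> disc \<Longrightarrow> \<exists>i<arcs. \<exists>s\<in>{-1..1}. x - par i s \<in> \<int>"
  using tangle_clauses[THEN conjunct2, THEN conjunct2, THEN conjunct2, THEN conjunct1] by blast

lemma over_par: "i < arcs \<Longrightarrow> s \<in> {-1..1} \<Longrightarrow> par i s \<in> over D \<longleftrightarrow> (i, s) \<in> tangle_over T"
  using tangle_clauses[THEN conjunct2, THEN conjunct2, THEN conjunct2, THEN conjunct2, THEN conjunct1]
  by blast

lemma virtual_disc: "virtual D \<inter> disc = \<phi> ` tangle_virtual T"
  using tangle_clauses[THEN conjunct2, THEN conjunct2, THEN conjunct2, THEN conjunct2, THEN conjunct2] .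

lemma abs_par_le: "s \<in> {-1..1} \<Longrightarrow> \<bar>par i s - c i\<bar> \<le> \<bar>r i\<bar>"
  by (auto simp: abs_mult intro!: mult_left_le)

lemma par_in_period: "i < arcs \<Longrightarrow> s \<in> {-1..1} \<Longrightarrow> par i s \<in> {t0..<t0 + 1}"
  using abs_par_le[of s i] arcs_in_period[of i] by (simp add: abs_le_iff)

lemma parI:
  assumes "i < arcs" "\<bar>x - c i\<bar> \<le> \<bar>r i\<bar>"
  obtains s where "s \<in> {-1..1}" "x = par i s"
proof
  have "\<bar>(x - c i) / r i\<bar> \<le> 1"
    unfolding abs_divide using assms r_nonzero[of i] by (simp add: divide_le_eq)
  then show "(x - c i) / r i \<in> {-1..1}" 
    unfolding atLeastAtMost_iff abs_le_iff by (intro conjI; linarith)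
  show "x = par i ((x - c i) / r i)" using r_nonzero[OF assms(1)] by simp
qed

lemma in_disc_iff: "curve D x \<in> disc \<longleftrightarrow> (\<exists>i<arcs. \<exists>s\<in>{-1..1}. x - par i s \<in> \<int>)"
proof
  assume "\<exists>i<arcs. \<exists>s\<in>{-1..1}. x - par i s \<in> \<int>"
  then obtain i s where *: "i < arcs" "s \<in> {-1..1}" "x - par i s \<in> \<int>" by blast
  then have "curve D x = \<phi> ((strands T ! i) s)"
    using curve_eq_mod_int[OF diagram] curve_par by metis
  then show "curve D x \<in> disc" using strands_in_square[OF *(1,2)] by simp
qed (rule in_disc_par)

text \<open>The intervals of two arcs do not meet, so the distance of their centres exceeds the sum of their
radii.\<close>

lemma par_less_par_iff:
  assumes "i < arcs" "j < arcs" "i \<noteq> j" "s \<in> {-1..1}" "t \<in> {-1..1}"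
  shows "par i s < par j t \<longleftrightarrow> c i < c j"
proof -
  have disjoint: "\<bar>x - c j\<bar> > \<bar>r j\<bar>" if x: "\<bar>x - c i\<bar> \<le> \<bar>r i\<bar>" for x
  proof (rule ccontr)
    assume "\<not> ?thesis"
    then have "\<bar>x - c j\<bar> \<le> \<bar>r j\<bar>" by simp
    then obtain s t where "s \<in> {-1..1}" "t \<in> {-1..1}" "x = par i s" "x = par j t"
      using parI[OF assms(1) x] parI[OF assms(2)] by metis
    then show False using par_eq_mod_int[OF assms(1,2), of s t] assms(3) by simp
  qed
  define A B where "A = \<bar>r i\<bar>" and "B = \<bar>r j\<bar>"
  have "A \<ge> 0" "B \<ge> 0" by (simp_all add: A_def B_def)
  then have "\<bar>c i - c j\<bar> > A + B"
    (* The point of the first interval closest to the other centre is that centre or an end point. *)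
    using disjoint[of "c j"] disjoint[of "c i + A"] disjoint[of "c i - A"]
    unfolding A_def[symmetric] B_def[symmetric] by (smt (verit))
  then show ?thesis 
    using abs_par_le[OF assms(4), of i] abs_par_le[OF assms(5), of j]
    unfolding A_def B_def by linarith
qed

lemma par_less_par_same:
  "i < arcs \<Longrightarrow> par i s < par i t \<longleftrightarrow> (if r i < 0 then t < s else s < t)"
  using r_nonzero[of i] by (auto simp: mult_less_cancel_left)

lemma outside_less_par_iff:
  assumes "i < arcs" "s \<in> {-1..1}" "curve D a \<notin> disc"
  shows "a < par i s \<longleftrightarrow> a < c i"
proof -
  have "\<bar>a - c i\<bar> > \<bar>r i\<bar>"
  proof (rule ccontr)
    assume "\<not> ?thesis"
    then obtain t where "t \<in> {-1..1}" "a = par i t" using parI[OF assms(1), of a] by auto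
    then have "a - par i t \<in> \<int>" by simp
    then have "curve D a \<in> disc" unfolding in_disc_iff using assms(1) \<open>t \<in> {-1..1}\<close> by blast
    then show False using assms(3) by simp
  qed
  then show ?thesis using abs_par_le[OF assms(2), of i] by linarith
qed

lemma tangle_meets_params:
  assumes "tangle_meets T i s j t"
  shows "par i s \<in> {t0..<t0 + 1}" "par j t \<in> {t0..<t0 + 1}" "par i s \<noteq> par j t"
    "curve D (par i s) = \<phi> ((strands T ! i) s)" "curve D (par j t) = \<phi> ((strands T ! i) s)"
proof -
  have *: "i < arcs" "j < arcs" "s \<in> {-1..1}" "t \<in> {-1..1}" "(i, s) \<noteq> (j, t)"
    "(strands T ! i) s = (strands T ! j) t"
    using assms by (auto simp: tangle_meets_def)
  show "par i s \<noteq> par j t"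
  proof
    assume "par i s = par j t"
    then have "par i s - par j t \<in> \<int>" by simp
    from par_eq_mod_int[OF *(1-4) this] *(5) show False by simp
  qed
  show "curve D (par i s) = \<phi> ((strands T ! i) s)" "curve D (par j t) = \<phi> ((strands T ! i) s)"
    using curve_par *(1-4,6) by auto
qed (use assms par_in_period in \<open>auto simp: tangle_meets_def\<close>)

text \<open>The four comparisons that decide the interlacement do not change when the parameters of the inner
crossing slide along their arcs to the centres. So an outer crossing is adjacent to an inner one if
and only if it separates the two arcs, wherever on these arcs the inner crossing lies.\<close>

lemma interlaced_outside_inside:
  assumes p: "p \<in> crossings D" "p \<notin> disc" and m: "tangle_meets T i s j t"
  shows "interlaced D p (\<phi> ((strands T ! i) s)) \<longleftrightarrow> odd_before D t0 p (c i) \<noteq> odd_before D t0 p (c j)"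
proof -
  obtain a b where ab: "a \<in> {t0..<t0 + 1}" "b \<in> {t0..<t0 + 1}" "a \<noteq> b" "curve D a = p" "curve D b = p"
    using crossing_preimages[OF diagram p(1)] .
  have *: "i < arcs" "j < arcs" "s \<in> {-1..1}" "t \<in> {-1..1}"
    using m by (auto simp: tangle_meets_def)
  have "p \<noteq> \<phi> ((strands T ! i) s)" using p(2) strands_in_square[OF *(1,3)] by auto
  then have "interlaced D p (\<phi> ((strands T ! i) s)) \<longleftrightarrow>
      ((a < par i s) \<noteq> (b < par i s)) \<noteq> ((a < par j t) \<noteq> (b < par j t))"
    using interlaced_iff[OF diagram ab tangle_meets_params[OF m]] by blast
  also have "\<dots> \<longleftrightarrow> ((a < c i) \<noteq> (b < c i)) \<noteq> ((a < c j) \<noteq> (b < c j))"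
    using outside_less_par_iff[OF *(1,3)] outside_less_par_iff[OF *(2,4)] p(2) ab(4,5) by simp
  finally show ?thesis by (simp add: odd_before_iff[OF diagram ab])
qed

lemma classical_crossings_in_disc: "classical_crossings D \<inter> disc = \<phi> ` tangle_crossings T"
proof -
  have meets: "p \<in> crossings D \<and> p \<in> disc \<longleftrightarrow> (\<exists>i s j t. tangle_meets T i s j t \<and> p = \<phi> ((strands T ! i) s))" for p
  proof
    assume "p \<in> crossings D \<and> p \<in> disc"
    then obtain a b where ab: "a - b \<notin> \<int>" "curve D a = p" "curve D b = p" "p \<in> disc"
      by (auto simp: crossings_def)
    then obtain i s j t where *: "i < arcs" "s \<in> {-1..1}" "a - par i s \<in> \<int>"
      "j < arcs" "t \<in> {-1..1}" "b - par j t \<in> \<int>"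
      using in_disc_iff by metis
    have p: "p = \<phi> ((strands T ! i) s)" "p = \<phi> ((strands T ! j) t)"
      using * ab curve_par curve_eq_mod_int[OF diagram] by metis+
    have "(i, s) \<noteq> (j, t)"
    proof
      assume "(i, s) = (j, t)"
      then have "a - b = (a - par i s) - (b - par j t)" by simp
      then show False using *(3,6) ab(1) Ints_diff by metis
    qed
    then have "tangle_meets T i s j t" using * p by (simp add: tangle_meets_def)
    then show "\<exists>i s j t. tangle_meets T i s j t \<and> p = \<phi> ((strands T ! i) s)" using p by blast
  next
    assume "\<exists>i s j t. tangle_meets T i s j t \<and> p = \<phi> ((strands T ! i) s)"
    then obtain i s j t where m: "tangle_meets T i s j t" and p: "p = \<phi> ((strands T ! i) s)" by blast
    note tm = tangle_meets_params[OF m]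
    have "par i s - par j t \<notin> \<int>" using eq_in_period[OF tm(1,2)] tm(3) by blast
    then have "p \<in> crossings D" using tm(4,5) p by (auto simp: crossings_def)
    then show "p \<in> crossings D \<and> p \<in> disc"
      using p strands_in_square[of i s] m by (auto simp: tangle_meets_def)
  qed
  have virt: "\<phi> z \<in> virtual D \<longleftrightarrow> z \<in> tangle_virtual T" if "z \<in> model_square" for z
  proof -
    have "\<phi> z \<in> virtual D \<longleftrightarrow> \<phi> z \<in> virtual D \<inter> disc" using that by simp
    also have "\<dots> \<longleftrightarrow> z \<in> tangle_virtual T" unfolding virtual_disc by auto
    finally show ?thesis .
  qed
  have square: "(strands T ! i) s \<in> model_square" if "tangle_meets T i s j t" for i s j t
    using that strands_in_square by (auto simp: tangle_meets_def)
  show ?thesis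
  proof (intro equalityI subsetI)
    fix p assume p: "p \<in> classical_crossings D \<inter> disc"
    then obtain i s j t where m: "tangle_meets T i s j t" "p = \<phi> ((strands T ! i) s)"
      using meets[of p] by (auto simp: classical_crossings_def)
    then have "(strands T ! i) s \<notin> tangle_virtual T"
      using p virt[OF square[OF m(1)]] by (simp add: classical_crossings_def)
    then show "p \<in> \<phi> ` tangle_crossings T"
      using m unfolding tangle_crossings_def by blast
  next
    fix p assume "p \<in> \<phi> ` tangle_crossings T"
    then obtain i s j t where m: "tangle_meets T i s j t" "p = \<phi> ((strands T ! i) s)"
      and v: "(strands T ! i) s \<notin> tangle_virtual T"
      unfolding tangle_crossings_def by blast
    then have "p \<notin> virtual D" using virt[OF square[OF m(1)]] by simp
    moreover have "p \<in> crossings D \<and> p \<in> disc" using meets[of p] m by blast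
    ultimately show "p \<in> classical_crossings D \<inter> disc" by (simp add: classical_crossings_def)
  qed
qed

text \<open>Near an interior parameter of an arc the curve is the composition of an affine change of parameter,
the model arc and the chart.\<close>

lemma tangent_par:
  assumes "i < arcs" "s \<in> {-1<..<1}" "((strands T ! i) has_vector_derivative v) (at s)"
  shows "tangent D (par i s) = (1 / r i) *\<^sub>R frechet_derivative \<phi> (at ((strands T ! i) s)) v"
proof -
  have r: "r i \<noteq> 0" by (rule r_nonzero[OF assms(1)])
  let ?g = "\<lambda>x. (x - c i) / r i"
  have "(?g has_vector_derivative 1 / r i) (at (par i s))"
    using r by (auto intro!: derivative_eq_intros simp: has_real_derivative_iff_has_vector_derivative[symmetric])
  moreover have g: "?g (par i s) = s" using r by simp
  ultimately have "((strands T ! i) \<circ> ?g has_vector_derivative (1 / r i) *\<^sub>R v) (at (par i s))"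
    using assms(3) by (intro vector_diff_chain_at) simp_all
  from has_vector_derivative_plane_diffeo[OF diffeo this]
  have "((\<lambda>x. \<phi> ((strands T ! i) (?g x))) has_vector_derivative
      frechet_derivative \<phi> (at ((strands T ! i) s)) ((1 / r i) *\<^sub>R v)) (at (par i s))"
    using g by simp
  moreover have "frechet_derivative \<phi> (at ((strands T ! i) s)) ((1 / r i) *\<^sub>R v) =
      (1 / r i) *\<^sub>R frechet_derivative \<phi> (at ((strands T ! i) s)) v"
    by (rule linear_scale[OF has_derivative_linear[OF plane_diffeo_has_derivative[OF diffeo]]])
  ultimately have d: "((\<lambda>x. \<phi> ((strands T ! i) (?g x))) has_vector_derivative
      (1 / r i) *\<^sub>R frechet_derivative \<phi> (at ((strands T ! i) s)) v) (at (par i s))"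
    by simp
  have "open (?g -` {-1<..<1})"
    by (rule open_vimage) (auto intro!: continuous_intros simp: r)
  then have "(curve D has_vector_derivative
      (1 / r i) *\<^sub>R frechet_derivative \<phi> (at ((strands T ! i) s)) v) (at (par i s))"
  proof (rule has_vector_derivative_transform_within_open[OF d])
    show "par i s \<in> ?g -` {-1<..<1}" using assms(2) g by simp
    fix x assume "x \<in> ?g -` {-1<..<1}"
    then have "curve D (par i (?g x)) = \<phi> ((strands T ! i) (?g x))"
      using assms(1) by (intro curve_par) auto
    then show "\<phi> ((strands T ! i) (?g x)) = curve D x" using r by simp
  qed
  then show ?thesis by (rule vector_derivative_at)
qed

text \<open>The determinant of the tangents is that of the model, multiplied by the positive Jacobian of the
chart and divided by \<open>r i * r j\<close>. The two factors \<open>r i\<close> and \<open>r j\<close> contribute the directions in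
which the arcs are traversed.\<close>

lemma negative_crossing_in_disc:
  assumes m: "tangle_meets T i s j t" and z: "(strands T ! i) s \<in> tangle_crossings T"
    and st: "s \<in> {-1<..<1}" "t \<in> {-1<..<1}"
    and d: "((strands T ! i) has_vector_derivative v) (at s)"
      "((strands T ! j) has_vector_derivative w) (at t)"
    and over: "(i, s) \<in> tangle_over T"
  shows "negative_crossing D (\<phi> ((strands T ! i) s)) \<longleftrightarrow> r i * r j * det2 v w < 0"
proof -
  let ?p = "\<phi> ((strands T ! i) s)"
  have *: "i < arcs" "j < arcs" "s \<in> {-1..1}" "t \<in> {-1..1}" "(strands T ! j) t = (strands T ! i) s"
    using m by (auto simp: tangle_meets_def)
  have p: "?p \<in> classical_crossings D" using classical_crossings_in_disc z by blast
  note tm = tangle_meets_params[OF m]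
  have o: "par i s \<in> over D" using over over_par[OF *(1,3)] by simp
  have "par i s - par j t \<notin> \<int>" using eq_in_period[OF tm(1,2)] tm(3) by blast
  then have u: "par j t \<notin> over D"
    using diagram p o tm(4,5) unfolding knot_diagram_def classical_crossings_def
    by (metis DiffD2)
  have strand: "x - par i s \<in> \<int> \<or> x - par j t \<in> \<int>" if "curve D x = ?p" for x
  proof -
    obtain n where n: "x - of_int n \<in> {t0..<t0 + 1}" using shift_into_period by blast
    have "curve D (x - of_int n) = ?p" using that curve_eq_mod_int[OF diagram, of "x - of_int n" x] by simp
    then have "x - of_int n = par i s \<or> x - of_int n = par j t"
      using preimage_in_period[OF diagram tm] n by blast
    then show ?thesis by (metis Ints_of_int add_diff_cancel_left' diff_add_cancel)
  qed
  have "negative_crossing D ?p \<longleftrightarrow> det2 (tangent D (par i s)) (tangent D (par j t)) < 0"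
  proof
    assume "negative_crossing D ?p"
    then obtain x y where xy: "curve D x = ?p" "curve D y = ?p" "x \<in> over D" "y \<notin> over D"
      "det2 (tangent D x) (tangent D y) < 0"
      by (auto simp: negative_crossing_def)
    have "x - par i s \<in> \<int>" "y - par j t \<in> \<int>"
      using strand[OF xy(1)] strand[OF xy(2)] xy(3,4) o u over_eq_mod_int[OF diagram] by metis+
    then show "det2 (tangent D (par i s)) (tangent D (par j t)) < 0"
      using xy(5) tangent_eq_mod_int[OF diagram] by metis
  qed (use p o u tm in \<open>unfold negative_crossing_def, blast\<close>)
  also have "\<dots> \<longleftrightarrow> 1 / r i * (1 / r j) * (jacobian \<phi> ((strands T ! i) s) * det2 v w) < 0"
    unfolding tangent_par[OF *(1) st(1) d(1)] tangent_par[OF *(2) st(2) d(2)] *(5)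
      det2_scaleR det2_frechet[OF diffeo] ..
  also have "\<dots> \<longleftrightarrow> r i * r j * det2 v w < 0"
  proof -
    have r: "r i \<noteq> 0" "r j \<noteq> 0" using r_nonzero * by auto
    have "1 / r i * (1 / r j) * (jacobian \<phi> ((strands T ! i) s) * det2 v w) =
        jacobian \<phi> ((strands T ! i) s) / (r i * r j)\<^sup>2 * (r i * r j * det2 v w)"
      using r by (simp add: power2_eq_square field_simps)
    moreover have "jacobian \<phi> ((strands T ! i) s) / (r i * r j)\<^sup>2 > 0"
      using jacobian_pos r by simp
    ultimately show ?thesis by (metis mult_less_cancel_left_pos mult_zero_right)
  qed
  finally show ?thesis .
qed

end

context tangle_in_diagram begin

lemma classical_crossing_in_disc:
  "p \<in> disc \<Longrightarrow> p \<in> classical_crossings D \<longleftrightarrow> p \<in> \<phi> ` tangle_crossings T"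
  using classical_crossings_in_disc by blast

lemma tangle_crossing_in_disc: "z \<in> tangle_crossings T \<Longrightarrow> \<phi> z \<in> disc"
  using classical_crossings_in_disc by blast

lemma interlaced_inside:
  assumes m: "tangle_meets T i s j t" "tangle_meets T k u l v"
    and ne: "(strands T ! i) s \<noteq> (strands T ! k) u"
  shows "interlaced D (\<phi> ((strands T ! i) s)) (\<phi> ((strands T ! k) u)) \<longleftrightarrow>
    ((par i s < par k u) \<noteq> (par j t < par k u)) \<noteq> ((par i s < par l v) \<noteq> (par j t < par l v))"
  using ne by (intro interlaced_iff[OF diagram tangle_meets_params[OF m(1)] tangle_meets_params[OF m(2)]]) simp

end

section \<open>Exchanging one tangle for another\<close>

lemma remove_verts_cong:
  assumes "finite_graph G" "verts G \<inter> W = verts G \<inter> W'"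
  shows "remove_verts G W = remove_verts G W'"
  by (rule graph_eqI)
    (use assms in \<open>auto simp: finite_graph_remove_verts adjacent_remove_verts looped_remove_verts\<close>)

lemma remove_verts_disjoint:
  assumes "finite_graph G" "verts G \<inter> W = {}"
  shows "remove_verts G W = G"
  by (rule graph_eqI)
    (use assms in \<open>auto simp: finite_graph_remove_verts adjacent_remove_verts looped_remove_verts\<close>)

text \<open>Both diagrams traverse the disc on the same parameter intervals and agree elsewhere, so everything
that is seen from outside the disc is common to them: the outer crossings, their signs, their
interlacement and their sides \<open>odd_before\<close>.\<close>

locale tangle_exchange =
  before: tangle_in_diagram D \<phi> c r T t0 + after: tangle_in_diagram D' \<phi> c r T' t0
  for D D' \<phi> c r T T' t0 +
  assumes arcs_eq: "length (strands T') = length (strands T)"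
    and outside: "\<And>t. curve D t \<notin> \<phi> ` model_square \<Longrightarrow>
        curve D' t = curve D t \<and> (t \<in> over D' \<longleftrightarrow> t \<in> over D)"
    and virtual_outside: "virtual D' - \<phi> ` model_square = virtual D - \<phi> ` model_square"
begin

abbreviation disc :: "complex set" where "disc \<equiv> \<phi> ` model_square"

abbreviation (input) G where "G \<equiv> looped_interlacement_graph D"
abbreviation (input) G' where "G' \<equiv> looped_interlacement_graph D'"

lemmas finite_G = finite_interlacement[OF before.diagram]
lemmas finite_G' = finite_interlacement[OF after.diagram]

lemma in_disc_eq: "curve D' t \<in> disc \<longleftrightarrow> curve D t \<in> disc"
  unfolding before.in_disc_iff after.in_disc_iff arcs_eq ..

lemma curve_outside: "p \<notin> disc \<Longrightarrow> curve D' t = p \<longleftrightarrow> curve D t = p"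
  using in_disc_eq[of t] outside[of t] by metis

lemma crossings_outside: "p \<notin> disc \<Longrightarrow> p \<in> classical_crossings D' \<longleftrightarrow> p \<in> classical_crossings D"
  using virtual_outside curve_outside unfolding classical_crossings_def crossings_def by blast

lemma interlaced_outside:
  "p \<notin> disc \<Longrightarrow> q \<notin> disc \<Longrightarrow> interlaced D' p q \<longleftrightarrow> interlaced D p q"
  unfolding interlaced_def by (simp add: curve_outside)

lemma odd_before_outside: "p \<notin> disc \<Longrightarrow> odd_before D' t0 p x \<longleftrightarrow> odd_before D t0 p x"
  unfolding odd_before_def by (simp add: curve_outside)

text \<open>The disc is compact, so the two curves coincide not only at \<open>t\<close> but in a neighbourhood of it.\<close>

lemma tangent_outside:
  assumes "curve D t \<notin> disc"
  shows "tangent D' t = tangent D t"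
proof -
  have cont: "continuous_on UNIV \<gamma>" if "\<And>t. (\<gamma> has_vector_derivative v t) (at t)" for \<gamma> :: "real \<Rightarrow> complex" and v
    using that has_vector_derivative_continuous continuous_at_imp_continuous_on by blast
  have "compact disc"
    using before.diffeo unfolding model_square_def plane_diffeo_def
    by (intro compact_continuous_image compact_cbox continuous_at_imp_continuous_on)
      (auto intro: differentiable_imp_continuous_within)
  then have "open (curve D -` (- disc))"
    using cont[OF curve_has_tangent[OF before.diagram]]
    by (intro open_vimage) (auto simp: compact_imp_closed open_Compl)
  then have "(curve D' has_vector_derivative tangent D t) (at t)"
    by (rule has_vector_derivative_transform_within_open[OF curve_has_tangent[OF before.diagram]])
      (use assms outside in auto)
  then show ?thesis by (rule vector_derivative_at)
qed

lemma negative_outside: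
  assumes "p \<notin> disc"
  shows "negative_crossing D' p \<longleftrightarrow> negative_crossing D p"
proof -
  have "(t \<in> over D' \<longleftrightarrow> t \<in> over D) \<and> tangent D' t = tangent D t" if "curve D t = p" for t
    using that assms outside tangent_outside by blast
  then show ?thesis
    unfolding negative_crossing_def crossings_outside[OF assms] curve_outside[OF assms] by metis
qed

lemma remove_disc_eq: "remove_verts G disc = remove_verts G' disc"
  by (rule graph_eqI)
    (use finite_G finite_G' in \<open>auto simp: finite_graph_remove_verts adjacent_remove_verts
      looped_remove_verts looped_interlacement crossings_outside negative_outside interlaced_outside
      adjacent_interlacement[OF before.diagram] adjacent_interlacement[OF after.diagram]\<close>)

lemma verts_G_in_disc: "verts G \<inter> disc = \<phi> ` tangle_crossings T"
  and verts_G'_in_disc: "verts G' \<inter> disc = \<phi> ` tangle_crossings T'"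
  using before.classical_crossings_in_disc after.classical_crossings_in_disc by simp_all

text \<open>The right hand sides involve the first diagram only: this is how neighbourhoods are carried across
a move.\<close>

lemma adjacent_outside_inside:
  assumes x: "x \<in> classical_crossings D" "x \<notin> disc"
  shows "tangle_meets T i s j t \<Longrightarrow> (strands T ! i) s \<in> tangle_crossings T \<Longrightarrow>
      adjacent G x (\<phi> ((strands T ! i) s)) \<longleftrightarrow> odd_before D t0 x (c i) \<noteq> odd_before D t0 x (c j)"
    and "tangle_meets T' i s j t \<Longrightarrow> (strands T' ! i) s \<in> tangle_crossings T' \<Longrightarrow>
      adjacent G' x (\<phi> ((strands T' ! i) s)) \<longleftrightarrow> odd_before D t0 x (c i) \<noteq> odd_before D t0 x (c j)"
proof -
  have c: "x \<in> crossings D" "x \<in> classical_crossings D'" "x \<in> crossings D'"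
    using x crossings_outside[OF x(2)] by (auto simp: classical_crossings_def)
  show "adjacent G x (\<phi> ((strands T ! i) s)) \<longleftrightarrow> odd_before D t0 x (c i) \<noteq> odd_before D t0 x (c j)"
    if "tangle_meets T i s j t" "(strands T ! i) s \<in> tangle_crossings T"
    using before.interlaced_outside_inside[OF c(1) x(2) that(1)] that(2) x(1)
      before.classical_crossings_in_disc
    by (auto simp: adjacent_interlacement[OF before.diagram])
  show "adjacent G' x (\<phi> ((strands T' ! i) s)) \<longleftrightarrow> odd_before D t0 x (c i) \<noteq> odd_before D t0 x (c j)"
    if "tangle_meets T' i s j t" "(strands T' ! i) s \<in> tangle_crossings T'"
    using after.interlaced_outside_inside[OF c(3) x(2) that(1)] that(2) c(2)
      after.classical_crossings_in_disc odd_before_outside[OF x(2)]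
    by (auto simp: adjacent_interlacement[OF after.diagram])
qed

lemma graph_eq_if_no_crossings:
  assumes "tangle_crossings T = {}" "tangle_crossings T' = {}"
  shows "G = G'"
proof -
  have "remove_verts G disc = G" "remove_verts G' disc = G'"
    using remove_verts_disjoint[OF finite_G] remove_verts_disjoint[OF finite_G']
      verts_G_in_disc verts_G'_in_disc assms by simp_all
  then show ?thesis using remove_disc_eq by metis
qed

lemma remove_new_crossings:
  assumes "tangle_crossings T = {}"
  shows "G = remove_verts G' (\<phi> ` tangle_crossings T')"
proof -
  have "G = remove_verts G disc"
    using remove_verts_disjoint[OF finite_G, of disc] verts_G_in_disc assms by simp
  also have "\<dots> = remove_verts G' disc" by (rule remove_disc_eq)
  also have "\<dots> = remove_verts G' (\<phi> ` tangle_crossings T')"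
    using verts_G'_in_disc by (intro remove_verts_cong[OF finite_G']) auto
  finally show ?thesis .
qed

text \<open>No outer crossing separates an arc from itself, so the crossing of a kink is isolated.\<close>

lemma Omega1_if_self_crossing:
  assumes "tangle_crossings T = {}" and T': "tangle_crossings T' = {(strands T' ! i) s}"
    and m: "tangle_meets T' i s i t"
  shows "Omega1 G' G"
  unfolding Omega1_def
proof (rule bexI, intro conjI ballI)
  let ?p = "\<phi> ((strands T' ! i) s)"
  show p: "?p \<in> verts G'" using after.classical_crossings_in_disc T' by auto
  show "G = remove_verts G' {?p}" using remove_new_crossings[OF assms(1)] T' by simp
  fix x assume x: "x \<in> verts G'"
  show "\<not> adjacent G' ?p x"
  proof (cases "x \<in> disc")
    case True
    then have "x = ?p" using x verts_G'_in_disc T' by auto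
    then show ?thesis by (simp add: adjacent_def)
  next
    case False
    then have "x \<in> classical_crossings D" using x crossings_outside by simp
    then show ?thesis
      using adjacent_outside_inside(2)[OF _ False m] T' by (simp add: adjacent_sym[of _ ?p])
  qed
qed

text \<open>Both crossings belong to the same pair of arcs, hence are separated by the same outer crossings.\<close>

lemma Omega2_if_two_crossings:
  assumes "tangle_crossings T = {}"
    and T': "tangle_crossings T' = {(strands T' ! i) s, (strands T' ! i) s'}"
    and m: "tangle_meets T' i s j t" "tangle_meets T' i s' j t'"
    and sign: "negative_crossing D' (\<phi> ((strands T' ! i) s))"
      "\<not> negative_crossing D' (\<phi> ((strands T' ! i) s'))"
  shows "Omega2 G' G"
proof -
  let ?p = "\<phi> ((strands T' ! i) s)" and ?q = "\<phi> ((strands T' ! i) s')"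
  have V: "?p \<in> verts G'" "?q \<in> verts G'" using after.classical_crossings_in_disc T' by auto
  have "adjacent G' x ?p \<longleftrightarrow> adjacent G' x ?q" if x: "x \<in> verts G' - {?p, ?q}" for x
  proof -
    have "x \<notin> disc" using x verts_G'_in_disc T' by auto
    moreover from this have "x \<in> classical_crossings D" using x crossings_outside by simp
    ultimately show ?thesis
      using adjacent_outside_inside(2)[OF _ _ m(1)] adjacent_outside_inside(2)[OF _ _ m(2)] T' by simp
  qed
  moreover have "G = remove_verts G' {?p, ?q}" using remove_new_crossings[OF assms(1)] T' by simp
  ultimately show ?thesis
    unfolding Omega2_def using V sign by (auto simp: looped_interlacement)
qed

text \<open>This serves the mixed move, where the arc that moves has only virtual crossings and the single
classical crossing stays in place.\<close>

lemma graph_eq_if_same_crossing: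
  assumes T: "tangle_crossings T = {z}" and T': "tangle_crossings T' = {z}"
    and m: "tangle_meets T i s j t" "tangle_meets T' i s j t"
    and z: "(strands T ! i) s = z" "(strands T' ! i) s = z"
    and sign: "negative_crossing D' (\<phi> z) \<longleftrightarrow> negative_crossing D (\<phi> z)"
  shows "G = G'"
proof (rule graph_eqI[OF finite_G finite_G'])
  have in_disc: "x = \<phi> z" if "x \<in> verts G" "x \<in> disc" for x
    using that verts_G_in_disc T by auto
  show "verts G = verts G'"
  proof -
    have "x \<in> verts G \<longleftrightarrow> x \<in> verts G'" for x
      using crossings_outside[of x] before.classical_crossing_in_disc[of x]
        after.classical_crossing_in_disc[of x] T T' by (cases "x \<in> disc") auto
    then show ?thesis by blast
  qed
  have outer: "adjacent G x (\<phi> z) \<longleftrightarrow> adjacent G' x (\<phi> z)" if "x \<in> verts G" "x \<notin> disc" for x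
    using adjacent_outside_inside(1)[OF _ _ m(1)] adjacent_outside_inside(2)[OF _ _ m(2)] that T T' z
    by simp
  fix x assume x: "x \<in> verts G"
  show "looped G x \<longleftrightarrow> looped G' x"
    using in_disc[OF x] negative_outside[of x] sign by (auto simp: looped_interlacement)
  fix y assume y: "y \<in> verts G"
  show "adjacent G x y \<longleftrightarrow> adjacent G' x y"
  proof (cases "x \<in> disc"; cases "y \<in> disc")
    assume "x \<in> disc" "y \<in> disc"
    then show ?thesis using in_disc[OF x] in_disc[OF y] by (simp add: adjacent_def)
  next
    assume "x \<in> disc" "y \<notin> disc"
    then show ?thesis using in_disc[OF x] outer[OF y] by (metis adjacent_sym)
  next
    assume "x \<notin> disc" "y \<in> disc"
    then show ?thesis using in_disc[OF y] outer[OF x] by simp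
  next
    assume "x \<notin> disc" "y \<notin> disc"
    then show ?thesis
      using x y crossings_outside interlaced_outside
      by (simp add: adjacent_interlacement before.diagram after.diagram)
  qed
qed

end

text \<open>Only the classes of the centres modulo 1 matter, so each arc can be moved to any period.\<close>

lemma contains_tangle_shift:
  assumes D: "knot_diagram D" and "contains_tangle \<phi> c r T D"
  shows "contains_tangle \<phi> (\<lambda>i. c i - of_int (m i)) r T D"
proof -
  let ?c = "\<lambda>i. c i - of_int (m i)" and ?n = "length (strands T)"
  have int: "(?c i + r i * s) - (c i + r i * s) \<in> \<int>" for i s
    by simp
  have int2: "(?c i + r i * s) - (?c j + r j * t) \<in> \<int> \<longleftrightarrow> (c i + r i * s) - (c j + r j * t) \<in> \<int>" for i s j t
  proof -
    have "(?c i + r i * s) - (?c j + r j * t) = (c i + r i * s) - (c j + r j * t) - of_int (m i - m j)"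
      by simp
    then show ?thesis by (metis Ints_add Ints_diff Ints_of_int diff_add_cancel)
  qed
  have int3: "x - (?c i + r i * s) \<in> \<int> \<longleftrightarrow> x - (c i + r i * s) \<in> \<int>" for x i s
  proof -
    have "x - (?c i + r i * s) = x - (c i + r i * s) + of_int (m i)" by simp
    then show ?thesis by (metis Ints_add Ints_diff Ints_of_int add_diff_cancel)
  qed
  have "curve D (?c i + r i * s) = curve D (c i + r i * s)"
    and "?c i + r i * s \<in> over D \<longleftrightarrow> c i + r i * s \<in> over D" for i s
    using curve_eq_mod_int[OF D int] over_eq_mod_int[OF D int] by blast+
  note same = this
  show ?thesis
    using assms(2) unfolding contains_tangle_def Let_def int2 unfolding int3 same .
qed

text \<open>The circle is cut at the starting point of the arc 0. Since the arcs are disjoint in \<open>\<real>/\<int>\<close>, no arc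
contains this point again, and each arc can be shifted by an integer into the period that begins
there.\<close>

lemma tangle_replacement_exchange:
  assumes D: "knot_diagram D" "knot_diagram D'" and rep: "tangle_replacement T T' D D'"
    and n: "length (strands T') = length (strands T)" "0 < length (strands T)"
    and sq: "\<And>i s. i < length (strands T) \<Longrightarrow> s \<in> {-1..1} \<Longrightarrow> (strands T ! i) s \<in> model_square"
      "\<And>i s. i < length (strands T) \<Longrightarrow> s \<in> {-1..1} \<Longrightarrow> (strands T' ! i) s \<in> model_square"
  obtains \<phi> c r t0 where "tangle_exchange D D' \<phi> c r T T' t0"
proof -
  let ?n = "length (strands T)"
  obtain \<phi> c r where \<phi>: "plane_diffeo \<phi>" "\<And>z. jacobian \<phi> z > 0"
    and T: "contains_tangle \<phi> c r T D" and T': "contains_tangle \<phi> c r T' D'"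
    and out: "\<And>t. curve D t \<notin> \<phi> ` model_square \<Longrightarrow>
           curve D' t = curve D t \<and> (t \<in> over D' \<longleftrightarrow> t \<in> over D)"
    and virt: "virtual D' - \<phi> ` model_square = virtual D - \<phi> ` model_square"
    using rep unfolding tangle_replacement_def by blast
  define t0 where "t0 = c 0 - \<bar>r 0\<bar>"
  define m where "m i = \<lfloor>c i - \<bar>r i\<bar> - t0\<rfloor>" for i
  let ?c = "\<lambda>i. c i - of_int (m i)"
  have m0: "m 0 = 0" by (simp add: m_def t0_def)
  have period: "t0 \<le> ?c i - \<bar>r i\<bar> \<and> ?c i + \<bar>r i\<bar> < t0 + 1" if i: "i < ?n" for i
  proof
    show "t0 \<le> ?c i - \<bar>r i\<bar>" unfolding m_def by linarith
    have less: "?c i - \<bar>r i\<bar> < t0 + 1" unfolding m_def by linarith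
    show "?c i + \<bar>r i\<bar> < t0 + 1"
    proof (rule ccontr)
      assume "\<not> ?thesis"
      with less have le: "\<bar>t0 + 1 - ?c i\<bar> \<le> \<bar>r i\<bar>" by linarith
      have "\<forall>i<?n. r i \<noteq> 0" using T unfolding contains_tangle_def Let_def by (elim conjE) assumption
      then have r: "r i \<noteq> 0" "r 0 \<noteq> 0" using i n(2) by blast+
      (* An arc reaching the end of the period would pass through the cut at the parameter s, where
         the arc 0 passes at its end u. *)
      define s where "s = (t0 + 1 - ?c i) / r i"
      have "\<bar>s\<bar> \<le> 1" using le r(1) by (simp add: s_def abs_divide divide_le_eq)
      then have s: "s \<in> {-1..1}" by auto
      define u where "u = - sgn (r 0)"
      have u: "u \<in> {-1..1}" by (auto simp: u_def sgn_if)
      have su: "?c i + r i * s = t0 + 1" "c 0 + r 0 * u = t0"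
        using r by (auto simp: s_def u_def t0_def sgn_if abs_if)
      then have "(c i + r i * s) - (c 0 + r 0 * u) = of_int (m i + 1)" by simp
      then have "(c i + r i * s) - (c 0 + r 0 * u) \<in> \<int>" by (metis Ints_of_int)
      moreover have "\<forall>i<?n. \<forall>j<?n. \<forall>s\<in>{-1..1}. \<forall>t\<in>{-1..1}.
          (c i + r i * s) - (c j + r j * t) \<in> \<int> \<longrightarrow> i = j \<and> s = t"
        using T unfolding contains_tangle_def Let_def by (elim conjE) assumption
      ultimately have "i = 0 \<and> s = u" using i n(2) s u by blast
      then show False using su m0 by simp
    qed
  qed
  have "tangle_exchange D D' \<phi> ?c r T T' t0"
  proof unfold_locales
    show "contains_tangle \<phi> ?c r T D" "contains_tangle \<phi> ?c r T' D'"
      using contains_tangle_shift T T' D by blast+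
  qed (use D \<phi> out virt n sq period in simp_all)
  then show ?thesis by (rule that)
qed

section \<open>The double points of the model tangles\<close>

lemma Complex_in_model_square:
  "Complex x y \<in> model_square \<longleftrightarrow> \<bar>x\<bar> \<le> 1 \<and> \<bar>y\<bar> \<le> 1"
  by (auto simp: model_square_def in_cbox_complex_iff abs_le_iff)

lemma graph_arc_derivative:
  "(f has_real_derivative d) (at s) \<Longrightarrow> ((\<lambda>s. Complex s (f s)) has_vector_derivative Complex 1 d) (at s)"
  by (simp add: has_vector_derivative_complex_iff)

lemma quartic_bounds:
  fixes s :: real
  assumes "s \<in> {-1..1}"
  shows "s^2 \<le> 1" "0 \<le> (1 - s^2)^2" "(1 - s^2)^2 \<le> 1"
proof -
  show "s^2 \<le> 1" using assms by (auto simp: abs_square_le_1 abs_le_iff)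
  then show "(1 - s^2)^2 \<le> 1" by (auto simp: abs_square_le_1 abs_le_iff intro: order_trans[of _ 0])
qed simp

lemma kink_arc_in_square: "s \<in> {-1..1} \<Longrightarrow> kink_arc s \<in> model_square"
proof -
  assume s: "s \<in> {-1..1}"
  define u where "u = s^2"
  have u: "0 \<le> u" "u \<le> 1" using quartic_bounds[OF s] by (simp_all add: u_def)
  have "(4 * u - 1) * (7 - 4 * u) = 9 - 16 * (1 - u)^2" by (simp add: power2_eq_square algebra_simps)
  moreover have "0 \<le> (1 - u)^2" "(1 - u)^2 \<le> 1" using quartic_bounds[OF s] by (simp_all add: u_def)
  ultimately have "\<bar>(4 * u - 1) * (7 - 4 * u)\<bar> \<le> 9" by linarith
  moreover have "\<bar>s\<bar> \<le> 1" using s by auto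
  ultimately have "\<bar>s\<bar> * \<bar>(4 * u - 1) * (7 - 4 * u)\<bar> \<le> 1 * 9" by (intro mult_mono) auto
  then have "\<bar>s * (4 * s^2 - 1) * (7 - 4 * s^2) / 9\<bar> \<le> 1"
    by (simp add: u_def abs_mult mult.assoc)
  then show ?thesis using quartic_bounds[OF s] by (simp add: kink_arc_def Complex_in_model_square)
qed

text \<open>Equal heights force \<open>t = - s\<close>, and the abscissa is an odd function, so it must vanish at both
parameters. Of its zeros, \<open>0\<close> gives no second parameter and \<open>7 = 4 * s^2\<close> lies outside the range.\<close>

lemma kink_arc_eq_iff:
  assumes "s \<in> {-1..1}" "t \<in> {-1..1}" "s \<noteq> t"
  shows "kink_arc s = kink_arc t \<longleftrightarrow> s = 1/2 \<and> t = -1/2 \<or> s = -1/2 \<and> t = 1/2"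
proof
  assume eq: "kink_arc s = kink_arc t"
  then have "(1 - s^2)^2 = (1 - t^2)^2" by (simp add: kink_arc_def)
  then have "s^2 = t^2"
    using quartic_bounds[OF assms(1)] quartic_bounds[OF assms(2)] by (simp add: power2_eq_iff_nonneg)
  then have t: "t = - s" using assms(3) by (simp add: power2_eq_iff)
  then have "s * (4 * s^2 - 1) * (7 - 4 * s^2) = 0" using eq by (simp add: kink_arc_def)
  moreover have "s \<noteq> 0" "7 - 4 * s^2 \<noteq> 0" using t assms(3) quartic_bounds[OF assms(1)] by auto
  ultimately have "s^2 = (1/2)^2" by (simp add: power2_eq_square)
  then show "s = 1/2 \<and> t = -1/2 \<or> s = -1/2 \<and> t = 1/2" using t by (auto simp: power2_eq_iff)
qed (elim disjE conjE, simp_all only: kink_arc_def, simp_all add: power2_eq_square)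

lemma kink_meets:
  "tangle_meets (kink P V) i s j t \<longleftrightarrow>
    i = 0 \<and> j = 0 \<and> (s = 1/2 \<and> t = -1/2 \<or> s = -1/2 \<and> t = 1/2)"
proof -
  have "tangle_meets (kink P V) i s j t \<longleftrightarrow> i = 0 \<and> j = 0 \<and> s \<in> {-1..1} \<and> t \<in> {-1..1} \<and> s \<noteq> t
      \<and> kink_arc s = kink_arc t"
    by (auto simp: tangle_meets_def kink_def)
  moreover have "s \<in> {-1..1} \<and> t \<in> {-1..1} \<and> s \<noteq> t" if "s = 1/2 \<and> t = -1/2 \<or> s = -1/2 \<and> t = 1/2"
    using that by (elim disjE conjE) simp_all
  ultimately show ?thesis using kink_arc_eq_iff[of s t] by metis
qed

lemma kink_crossings: "tangle_crossings (kink P V) = {kink_arc (1/2)} - V"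
proof -
  have strand: "strands (kink P V) ! 0 = kink_arc" by (simp add: kink_def)
  have "kink_arc (-1/2) = kink_arc (1/2)" by (simp add: kink_arc_def power2_eq_square)
  then have z: "z = kink_arc (1/2)"
    if m: "tangle_meets (kink P V) i s j t" and "z = (strands (kink P V) ! i) s" for z i s j t
  proof -
    have "i = 0" "s = 1/2 \<or> s = -1/2" using m[unfolded kink_meets] by blast+
    then show ?thesis using that(2) strand \<open>kink_arc (-1/2) = kink_arc (1/2)\<close> by metis
  qed
  have "tangle_meets (kink P V) 0 (1/2) 0 (-1/2)" by (simp add: kink_meets)
  then have "kink_arc (1/2) \<in> {(strands (kink P V) ! i) s | i s j t. tangle_meets (kink P V) i s j t}"
    unfolding mem_Collect_eq by (intro exI[of _ 0] exI[of _ "1/2"] exI[of _ "-1/2"]) (simp add: strand)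
  then have "{(strands (kink P V) ! i) s | i s j t. tangle_meets (kink P V) i s j t} = {kink_arc (1/2)}"
    using z by (intro equalityI subsetI) blast+
  then show ?thesis by (simp only: tangle_crossings_def) (simp add: kink_def)
qed

lemma no_kink_crossings: "tangle_crossings no_kink = {}"
  by (auto simp: tangle_crossings_def tangle_meets_def no_kink_def axis_arc_def)

text \<open>All the arcs in the second and third moves are graphs of functions of the abscissa. Hence none of
them crosses itself, and two of them meet at the same value of their parameters.\<close>

lemma tangle_of_meets:
  assumes "\<forall>a\<in>set as. \<forall>s. Re (a s) = s"
  shows "tangle_meets (tangle_of as R) i s j t \<longleftrightarrow>
    i < length as \<and> j < length as \<and> i \<noteq> j \<and> s = t \<and> s \<in> {-1..1} \<and> (as ! i) s = (as ! j) s"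
proof -
  have "s = t" if "i < length as" "j < length as" "(as ! i) s = (as ! j) t" for i j
    using assms[rule_format, of "as ! i" s] assms[rule_format, of "as ! j" t] that by simp
  then show ?thesis unfolding tangle_meets_def tangle_of_def by auto
qed

lemma tangle_of_over:
  assumes "\<forall>a\<in>set as. \<forall>s. Re (a s) = s"
  shows "(i, s) \<in> tangle_over (tangle_of as R) \<longleftrightarrow> (\<exists>j. tangle_meets (tangle_of as R) i s j s \<and> R i j)"
proof
  assume "(i, s) \<in> tangle_over (tangle_of as R)"
  then obtain j t where *: "i < length as" "s \<in> {-1..1}" "j < length as" "i \<noteq> j" "(as ! i) s = (as ! j) t" "R i j"
    by (auto simp: tangle_of_def)
  then have "t = s" using assms[rule_format, of "as ! i" s] assms[rule_format, of "as ! j" t] by simp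
  then show "\<exists>j. tangle_meets (tangle_of as R) i s j s \<and> R i j"
    unfolding tangle_of_meets[OF assms] using * by blast
next
  assume "\<exists>j. tangle_meets (tangle_of as R) i s j s \<and> R i j"
  then obtain j where "i < length as" "s \<in> {-1..1}" "j < length as" "i \<noteq> j" "(as ! i) s = (as ! j) s" "R i j"
    unfolding tangle_of_meets[OF assms] by blast
  then show "(i, s) \<in> tangle_over (tangle_of as R)"
    unfolding tangle_of_def tangle.select_convs mem_Collect_eq case_prod_conv
    by (intro conjI exI[of _ j] bexI[of _ s])
qed

lemma tangle_of_virtual:
  assumes "\<forall>a\<in>set as. \<forall>s. Re (a s) = s"
  shows "z \<in> tangle_virtual (tangle_of as R) \<longleftrightarrow>
    (\<exists>i j. tangle_meets (tangle_of as R) i (Re z) j (Re z) \<and> (as ! i) (Re z) = z \<and> \<not> R i j \<and> \<not> R j i)"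
proof -
  have *: "s = Re z" if "i < length as" "(as ! i) s = z" for i s
    using assms[rule_format, of "as ! i" s] that by auto
  show ?thesis
  proof
    assume "z \<in> tangle_virtual (tangle_of as R)"
    then obtain i j s t where "i < length as" "j < length as" "s \<in> {-1..1}" "t \<in> {-1..1}" "i \<noteq> j"
      "(as ! i) s = z" "(as ! j) t = z" "\<not> R i j" "\<not> R j i"
      by (auto simp: tangle_of_def)
    then show "\<exists>i j. tangle_meets (tangle_of as R) i (Re z) j (Re z) \<and> (as ! i) (Re z) = z \<and> \<not> R i j \<and> \<not> R j i"
      using *[of i s] *[of j t] unfolding tangle_of_meets[OF assms] by (intro exI[of _ i] exI[of _ j]) auto
  next
    assume "\<exists>i j. tangle_meets (tangle_of as R) i (Re z) j (Re z) \<and> (as ! i) (Re z) = z \<and> \<not> R i j \<and> \<not> R j i"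
    then obtain i j where *: "i < length as" "j < length as" "Re z \<in> {-1..1}" "i \<noteq> j"
      "(as ! i) (Re z) = z" "(as ! j) (Re z) = z" "\<not> R i j" "\<not> R j i"
      unfolding tangle_of_meets[OF assms] by auto
    show "z \<in> tangle_virtual (tangle_of as R)"
      unfolding tangle_of_def tangle.select_convs mem_Collect_eq
      by (rule exI[of _ i], rule conjI[OF *(1)], rule exI[of _ j]) (intro conjI bexI[of _ "Re z"] *)
  qed
qed

lemma strands_tangle_of [simp]: "strands (tangle_of as R) = as"
  by (simp add: tangle_of_def)

lemma tangle_of_two_meets:
  assumes "\<forall>a\<in>set [a, b]. \<forall>s. Re (a s) = s"
  shows "tangle_meets (tangle_of [a, b] R) i s j t \<longleftrightarrow>
    s = t \<and> s \<in> {-1..1} \<and> a s = b s \<and> (i = 0 \<and> j = 1 \<or> i = 1 \<and> j = 0)"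
proof -
  have lt: "k < length [a, b] \<longleftrightarrow> k = 0 \<or> k = 1" for k by auto
  have sym: "b s = a s \<longleftrightarrow> a s = b s" by (rule eq_commute)
  consider "i = 0" "j = 0" | "i = 0" "j = 1" | "i = 1" "j = 0" | "i = 1" "j = 1"
    | "\<not> (i = 0 \<or> i = 1)" | "\<not> (j = 0 \<or> j = 1)"
    by blast
  then show ?thesis
    unfolding tangle_of_meets[OF assms] lt by cases (simp_all add: sym conj_commute)
qed

lemma R2_before_crossings: "tangle_crossings (tangle_of [high_arc, axis_arc] R) = {}"
proof -
  have "\<forall>a\<in>set [high_arc, axis_arc]. \<forall>s. Re (a s) = s"
    by (simp add: high_arc_def axis_arc_def)
  from tangle_of_two_meets[OF this] show ?thesis
    by (simp add: tangle_crossings_def high_arc_def axis_arc_def)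
qed

lemma dip_arc_axis:
  assumes "s \<in> {-1..1}"
  shows "dip_arc s = axis_arc s \<longleftrightarrow> s = 1/2 \<or> s = -1/2"
proof
  assume "dip_arc s = axis_arc s"
  then have "(1 - s^2)^2 = (3/4)^2" by (simp add: dip_arc_def axis_arc_def power2_eq_square)
  then have "1 - s^2 = 3/4" using quartic_bounds(1)[OF assms] by (subst (asm) power2_eq_iff_nonneg) auto
  then have "s^2 = (1/2)^2" by (simp add: power2_eq_square)
  then show "s = 1/2 \<or> s = -1/2" by (simp add: power2_eq_iff)
qed (elim disjE, simp_all only: dip_arc_def axis_arc_def, simp_all add: power2_eq_square)

lemma R2_meets:
  "tangle_meets (tangle_of [dip_arc, axis_arc] R) i s j t \<longleftrightarrow>
    s = t \<and> (s = 1/2 \<or> s = -1/2) \<and> (i = 0 \<and> j = 1 \<or> i = 1 \<and> j = 0)"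
proof -
  have "\<forall>a\<in>set [dip_arc, axis_arc]. \<forall>s. Re (a s) = s"
    by (simp add: dip_arc_def axis_arc_def)
  from tangle_of_two_meets[OF this] show ?thesis using dip_arc_axis[of s] by auto
qed

lemma R2_crossings:
  "tangle_crossings (tangle_of [dip_arc, axis_arc] R) =
    (if R 0 1 \<or> R 1 0 then {dip_arc (1/2), dip_arc (-1/2)} else {})"
proof -
  let ?T = "tangle_of [dip_arc, axis_arc] R"
  have Re: "\<forall>a\<in>set [dip_arc, axis_arc]. \<forall>s. Re (a s) = s"
    by (simp add: dip_arc_def axis_arc_def)
  have eq: "axis_arc s = dip_arc s" if "s = 1/2 \<or> s = -1/2" for s
    using that dip_arc_axis[of s] by auto
  have meets: "z \<in> {(strands ?T ! i) s | i s j t. tangle_meets ?T i s j t} \<longleftrightarrow>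
      z \<in> {dip_arc (1/2), dip_arc (-1/2)}" for z
  proof
    assume "z \<in> {(strands ?T ! i) s | i s j t. tangle_meets ?T i s j t}"
    then obtain i s j t where m: "tangle_meets ?T i s j t" and z: "z = (strands ?T ! i) s" by blast
    then have s: "s = 1/2 \<or> s = -1/2" and "i = 0 \<or> i = 1" unfolding R2_meets by auto
    then have "z = dip_arc s" using z eq[OF s] by auto
    then show "z \<in> {dip_arc (1/2), dip_arc (-1/2)}" using s by blast
  next
    assume "z \<in> {dip_arc (1/2), dip_arc (-1/2)}"
    then obtain s where s: "s = 1/2 \<or> s = -1/2" and z: "z = dip_arc s" by blast
    have "tangle_meets ?T 0 s 1 s" using s by (simp add: R2_meets)
    moreover have "z = (strands ?T ! 0) s" using z by simp
    ultimately show "z \<in> {(strands ?T ! i) s | i s j t. tangle_meets ?T i s j t}" by blast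
  qed
  have virt: "z \<in> tangle_virtual ?T \<longleftrightarrow> \<not> R 0 1 \<and> \<not> R 1 0"
    if "z \<in> {dip_arc (1/2), dip_arc (-1/2)}" for z
  proof -
    obtain s where s: "s = 1/2 \<or> s = -1/2" and z: "z = dip_arc s" using \<open>z \<in> _\<close> by blast
    have Re_z: "Re z = s" using z by (simp add: dip_arc_def)
    show ?thesis
      unfolding tangle_of_virtual[OF Re] R2_meets Re_z
    proof
      assume "\<not> R 0 1 \<and> \<not> R 1 0"
      then show "\<exists>i j. (s = s \<and> (s = 1/2 \<or> s = -1/2) \<and> (i = 0 \<and> j = 1 \<or> i = 1 \<and> j = 0)) \<and>
          ([dip_arc, axis_arc] ! i) s = z \<and> \<not> R i j \<and> \<not> R j i"
        using s z by (intro exI[of _ 0] exI[of _ 1]) simp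
    qed auto
  qed
  show ?thesis
    unfolding tangle_crossings_def using meets virt by auto
qed

text \<open>The arc that is moved in a third move, with \<open>e = 1\<close> before and \<open>e = -1\<close> after the move. It meets
the arcs 1 and 2 at the parameters \<open>e / 2\<close> and \<open>- e / 2\<close>, which themselves meet at 0, so the
two tangles can be treated together.\<close>

definition bump_arc :: "real \<Rightarrow> real \<Rightarrow> complex" where
  "bump_arc e s = Complex s (e * ((1 - s^2)^2 / 2))"

definition R3_tangle :: "real \<Rightarrow> (nat \<Rightarrow> nat \<Rightarrow> bool) \<Rightarrow> tangle" where
  "R3_tangle e R = tangle_of [bump_arc e, rising_arc, falling_arc] R"

lemma R3_pair_eq: "R3_pair R = (R3_tangle 1 R, R3_tangle (-1) R)"
proof -
  have "upper_arc = bump_arc 1" "lower_arc = bump_arc (-1)"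
    by (simp_all add: fun_eq_iff upper_arc_def lower_arc_def bump_arc_def)
  then show ?thesis by (simp add: R3_pair_def R3_tangle_def)
qed

lemma Re_R3_arcs: "\<forall>a\<in>set [bump_arc e, rising_arc, falling_arc]. \<forall>s. Re (a s) = s"
  by (simp add: bump_arc_def rising_arc_def falling_arc_def)

lemma bump_rising_root:
  fixes s :: real
  assumes "s \<in> {-1..1}"
  shows "(1 - s^2)^2 / 2 = 9/16 * s \<longleftrightarrow> s = 1/2"
proof
  assume eq: "(1 - s^2)^2 / 2 = 9/16 * s"
  then have s: "0 \<le> s" using quartic_bounds(2)[OF assms] by linarith
  have "s \<le> 1" using assms by simp
  note s = s this
  (* The equation is a quartic with the root 1/2; the cubic cofactor is negative on the unit interval. *)
  have "(2 * s - 1) * (4 * s^3 + 2 * s^2 - 7 * s - 8) = 0"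
    using eq by (simp add: algebra_simps power2_eq_square power3_eq_cube)
  moreover have "s^2 \<le> s" "s^3 \<le> s" using s by (simp_all add: power2_eq_square power3_eq_cube mult_left_le_one_le mult_le_one)
  then have "4 * s^3 + 2 * s^2 - 7 * s - 8 \<noteq> 0" using s by linarith
  ultimately show "s = 1/2" by simp
next
  assume s: "s = 1/2"
  show "(1 - s^2)^2 / 2 = 9/16 * s" unfolding s by (simp add: power2_eq_square)
qed

lemma R3_arcs_eq_iff:
  assumes e: "e = 1 \<or> e = -1" and s: "s \<in> {-1..1}"
  shows "bump_arc e s = rising_arc s \<longleftrightarrow> s = e / 2"
    and "bump_arc e s = falling_arc s \<longleftrightarrow> s = - e / 2"
    and "rising_arc s = falling_arc s \<longleftrightarrow> s = 0"
  using e bump_rising_root[OF s] bump_rising_root[of "- s"] s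
  by (auto simp: bump_arc_def rising_arc_def falling_arc_def)

lemma R3_meets:
  assumes e: "e = 1 \<or> e = -1"
  shows "tangle_meets (R3_tangle e R) i s j t \<longleftrightarrow> s = t \<and>
    ((i = 0 \<and> j = 1 \<or> i = 1 \<and> j = 0) \<and> s = e / 2 \<or>
     (i = 0 \<and> j = 2 \<or> i = 2 \<and> j = 0) \<and> s = - e / 2 \<or>
     (i = 1 \<and> j = 2 \<or> i = 2 \<and> j = 1) \<and> s = 0)"
proof (cases "s \<in> {-1..1}")
  case True
  have lt: "k < length [bump_arc e, rising_arc, falling_arc] \<longleftrightarrow> k = 0 \<or> k = 1 \<or> k = 2" for k
    by auto
  note eq = R3_arcs_eq_iff[OF e True]
  have eq': "rising_arc s = bump_arc e s \<longleftrightarrow> s = e / 2" "falling_arc s = bump_arc e s \<longleftrightarrow> s = - e / 2"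
    "falling_arc s = rising_arc s \<longleftrightarrow> s = 0"
    using eq by auto
  consider "i = j" | "i = 0" "j = 1" | "i = 1" "j = 0" | "i = 0" "j = 2" | "i = 2" "j = 0"
    | "i = 1" "j = 2" | "i = 2" "j = 1" | "\<not> (i = 0 \<or> i = 1 \<or> i = 2)" | "\<not> (j = 0 \<or> j = 1 \<or> j = 2)"
    by blast
  then show ?thesis
    unfolding R3_tangle_def tangle_of_meets[OF Re_R3_arcs] lt
    by cases (use True in \<open>simp_all add: eq eq'\<close>)
next
  case False
  then have "s \<noteq> e / 2" "s \<noteq> - e / 2" "s \<noteq> 0" using e by auto
  then show ?thesis
    unfolding R3_tangle_def tangle_of_meets[OF Re_R3_arcs] using False by blast
qed

lemma R3_over:
  assumes e: "e = 1 \<or> e = -1"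
  shows "(0, e / 2) \<in> tangle_over (R3_tangle e R) \<longleftrightarrow> R 0 1"
    and "(1, e / 2) \<in> tangle_over (R3_tangle e R) \<longleftrightarrow> R 1 0"
    and "(0, - e / 2) \<in> tangle_over (R3_tangle e R) \<longleftrightarrow> R 0 2"
    and "(2, - e / 2) \<in> tangle_over (R3_tangle e R) \<longleftrightarrow> R 2 0"
    and "(1, 0) \<in> tangle_over (R3_tangle e R) \<longleftrightarrow> R 1 2"
    and "(2, 0) \<in> tangle_over (R3_tangle e R) \<longleftrightarrow> R 2 1"
  using e unfolding R3_tangle_def tangle_of_over[OF Re_R3_arcs]
  unfolding R3_tangle_def[symmetric] R3_meets[OF e] by auto

lemma R3_crossings:
  assumes e: "e = 1 \<or> e = -1"
  shows "tangle_crossings (R3_tangle e R) =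
    (if R 0 1 \<or> R 1 0 then {bump_arc e (e / 2)} else {}) \<union>
    (if R 0 2 \<or> R 2 0 then {bump_arc e (- e / 2)} else {}) \<union>
    (if R 1 2 \<or> R 2 1 then {rising_arc 0} else {})"
proof -
  let ?T = "R3_tangle e R" and ?as = "[bump_arc e, rising_arc, falling_arc]"
  have "e / 2 \<in> {-1..1}" "- e / 2 \<in> {-1..1}" using e by auto
  then have eq: "rising_arc (e / 2) = bump_arc e (e / 2)" "falling_arc (- e / 2) = bump_arc e (- e / 2)"
    "falling_arc 0 = rising_arc 0"
    using R3_arcs_eq_iff[OF e, of "e / 2"] R3_arcs_eq_iff[OF e, of "- e / 2"] R3_arcs_eq_iff[OF e, of 0]
    by simp_all
  have strands: "strands ?T = ?as" by (simp add: R3_tangle_def)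
  have Re: "Re (bump_arc e s) = s" "Re (rising_arc s) = s" for s
    by (simp_all add: bump_arc_def rising_arc_def)
  have meets: "z \<in> {(strands ?T ! i) s | i s j t. tangle_meets ?T i s j t} \<longleftrightarrow>
      z = bump_arc e (e / 2) \<or> z = bump_arc e (- e / 2) \<or> z = rising_arc 0" for z
  proof
    assume "z \<in> {(strands ?T ! i) s | i s j t. tangle_meets ?T i s j t}"
    then show "z = bump_arc e (e / 2) \<or> z = bump_arc e (- e / 2) \<or> z = rising_arc 0"
      unfolding R3_meets[OF e] strands using eq by auto
  next
    have mem: "z \<in> {(strands ?T ! i) s | i s j t. tangle_meets ?T i s j t}"
      if "tangle_meets ?T i s j t" "(strands ?T ! i) s = z" for i s j t
      using that by blast
    assume "z = bump_arc e (e / 2) \<or> z = bump_arc e (- e / 2) \<or> z = rising_arc 0"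
    then show "z \<in> {(strands ?T ! i) s | i s j t. tangle_meets ?T i s j t}"
    proof (elim disjE)
      assume "z = bump_arc e (e / 2)"
      then show ?thesis by (intro mem[of 0 "e / 2" 1 "e / 2"]) (simp_all add: R3_meets[OF e] strands)
    next
      assume "z = bump_arc e (- e / 2)"
      then show ?thesis by (intro mem[of 0 "- e / 2" 2 "- e / 2"]) (simp_all add: R3_meets[OF e] strands)
    next
      assume "z = rising_arc 0"
      then show ?thesis by (intro mem[of 1 0 2 0]) (simp_all add: R3_meets[OF e] strands)
    qed
  qed
  have virt: "z \<in> tangle_virtual ?T \<longleftrightarrow>
      (\<exists>i j. tangle_meets ?T i (Re z) j (Re z) \<and> (?as ! i) (Re z) = z \<and> \<not> R i j \<and> \<not> R j i)" for z
    unfolding R3_tangle_def by (rule tangle_of_virtual[OF Re_R3_arcs])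
  have ne: "e / 2 \<noteq> - e / 2" "e / 2 \<noteq> 0" "- e / 2 \<noteq> 0" using e by auto
  note virt_iff = virt[unfolded R3_meets[OF e]]
  have v01: "bump_arc e (e / 2) \<in> tangle_virtual ?T \<longleftrightarrow> \<not> R 0 1 \<and> \<not> R 1 0"
  proof
    assume "\<not> R 0 1 \<and> \<not> R 1 0"
    then show "bump_arc e (e / 2) \<in> tangle_virtual ?T"
      unfolding virt_iff Re using e by (intro exI[of _ 0] exI[of _ 1]) simp
  qed (use ne in \<open>auto simp: virt_iff Re\<close>)
  have v02: "bump_arc e (- e / 2) \<in> tangle_virtual ?T \<longleftrightarrow> \<not> R 0 2 \<and> \<not> R 2 0"
  proof
    assume "\<not> R 0 2 \<and> \<not> R 2 0"
    then show "bump_arc e (- e / 2) \<in> tangle_virtual ?T"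
      unfolding virt_iff Re using e by (intro exI[of _ 0] exI[of _ 2]) simp
  qed (use ne in \<open>auto simp: virt_iff Re\<close>)
  have v12: "rising_arc 0 \<in> tangle_virtual ?T \<longleftrightarrow> \<not> R 1 2 \<and> \<not> R 2 1"
  proof
    assume "\<not> R 1 2 \<and> \<not> R 2 1"
    then show "rising_arc 0 \<in> tangle_virtual ?T"
      unfolding virt_iff Re using e by (intro exI[of _ 1] exI[of _ 2]) simp
  qed (use ne in \<open>auto simp: virt_iff Re\<close>)
  show ?thesis
    unfolding tangle_crossings_def using meets v01 v02 v12 by auto
qed

section \<open>The graphs before and after each move\<close>

lemma rising_arc_derivative: "(rising_arc has_vector_derivative Complex 1 (9/16)) (at s)"
  unfolding rising_arc_def by (rule graph_arc_derivative) (auto intro!: derivative_eq_intros)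

lemma falling_arc_derivative: "(falling_arc has_vector_derivative Complex 1 (-9/16)) (at s)"
  unfolding falling_arc_def by (rule graph_arc_derivative) (auto intro!: derivative_eq_intros)

lemma scaled_product_neg_iff:
  fixes a b k :: real
  assumes "a \<noteq> 0" "b \<noteq> 0"
  shows "k > 0 \<Longrightarrow> a * b * k < 0 \<longleftrightarrow> (a < 0) \<noteq> (b < 0)"
    and "k < 0 \<Longrightarrow> a * b * k < 0 \<longleftrightarrow> (a < 0) = (b < 0)"
  using assms by (auto simp: mult_less_0_iff zero_less_mult_iff)

lemma tangle_meets_commute: "tangle_meets T i s j t \<longleftrightarrow> tangle_meets T j t i s"
  unfolding tangle_meets_def by auto

context tangle_in_diagram begin

text \<open>The sign of a crossing, whichever of the two arcs is the upper one. Exchanging the roles of the arcs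
changes the sign of the determinant.\<close>

lemma negative_crossing_of_arcs:
  assumes m: "tangle_meets T i s j t" and z: "(strands T ! i) s \<in> tangle_crossings T"
    and st: "s \<in> {-1<..<1}" "t \<in> {-1<..<1}"
    and d: "((strands T ! i) has_vector_derivative v) (at s)"
      "((strands T ! j) has_vector_derivative w) (at t)"
    and over: "(i, s) \<in> tangle_over T \<or> (j, t) \<in> tangle_over T"
    and det: "det2 v w \<noteq> 0"
  shows "negative_crossing D (\<phi> ((strands T ! i) s)) \<longleftrightarrow>
    (((r i < 0) = (r j < 0)) = ((i, s) \<in> tangle_over T \<longleftrightarrow> det2 v w < 0))"
proof -
  have r: "r i \<noteq> 0" "r j \<noteq> 0" using m r_nonzero by (auto simp: tangle_meets_def)
  have swap: "det2 w v = - det2 v w" by (simp add: det2_def)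
  show ?thesis
  proof (cases "(i, s) \<in> tangle_over T")
    case True
    then show ?thesis
      using negative_crossing_in_disc[OF m z st d True] scaled_product_neg_iff[OF r, of "det2 v w"] det
      by (cases "det2 v w < 0") auto
  next
    case False
    have e: "(strands T ! j) t = (strands T ! i) s" using m by (simp add: tangle_meets_def)
    have "negative_crossing D (\<phi> ((strands T ! i) s)) \<longleftrightarrow> r j * r i * det2 w v < 0"
      using negative_crossing_in_disc[of j t i s w v] m z st d False over
      by (simp add: e tangle_meets_commute[of T j])
    then show ?thesis
      using scaled_product_neg_iff[OF r(2,1), of "det2 w v"] det False
      by (cases "det2 v w < 0") (auto simp: swap)
  qed
qed

text \<open>In the adjacencies \<open>e\<close> enters once each, namely through the order of the two crossings on the arc
that the two crossings share. So changing the sign of \<open>e\<close> toggles all three adjacencies. The loops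
do not depend on \<open>e\<close> since the determinants of the tangents do not.\<close>

lemma R3_graph:
  assumes T: "T = R3_tangle e R" and e: "e = 1 \<or> e = -1"
    and R: "R 0 1 \<or> R 1 0" "R 0 2 \<or> R 2 0" "R 1 2 \<or> R 2 1"
  defines "p01 \<equiv> \<phi> (bump_arc e (e / 2))" and "p02 \<equiv> \<phi> (bump_arc e (- e / 2))" and "p12 \<equiv> \<phi> (rising_arc 0)"
    and "G \<equiv> looped_interlacement_graph D"
  shows "adjacent G p01 p02 \<longleftrightarrow> (((r 0 < 0) = (0 < e)) \<noteq> (c 1 < c 0)) \<noteq> ((c 0 < c 2) \<noteq> (c 1 < c 2))"
    and "adjacent G p01 p12 \<longleftrightarrow> ((c 0 < c 1) \<noteq> ((r 1 < 0) = (0 < e))) \<noteq> ((c 0 < c 2) \<noteq> (c 1 < c 2))"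
    and "adjacent G p02 p12 \<longleftrightarrow> ((c 0 < c 1) \<noteq> (c 2 < c 1)) \<noteq> ((c 0 < c 2) \<noteq> ((r 2 < 0) \<noteq> (0 < e)))"
    and "looped G p01 \<longleftrightarrow> ((r 0 < 0) = (r 1 < 0)) = (\<not> R 0 1)"
    and "looped G p02 \<longleftrightarrow> ((r 0 < 0) = (r 2 < 0)) = R 0 2"
    and "looped G p12 \<longleftrightarrow> ((r 1 < 0) = (r 2 < 0)) = R 1 2"
proof -
  have arcs: "arcs = 3" and strands: "strands T ! 0 = bump_arc e" "strands T ! 1 = rising_arc"
    "strands T ! 2 = falling_arc"
    by (simp_all add: T R3_tangle_def)
  have m: "tangle_meets T 0 (e / 2) 1 (e / 2)" "tangle_meets T 0 (- e / 2) 2 (- e / 2)"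
    "tangle_meets T 1 0 2 0"
    by (simp_all add: T R3_meets[OF e])
  have crossings: "tangle_crossings T = {bump_arc e (e / 2), bump_arc e (- e / 2), rising_arc 0}"
    using R unfolding T R3_crossings[OF e] by auto
  have ne: "bump_arc e (e / 2) \<noteq> bump_arc e (- e / 2)" "bump_arc e (e / 2) \<noteq> rising_arc 0"
    "bump_arc e (- e / 2) \<noteq> rising_arc 0"
    using e by (auto simp: bump_arc_def rising_arc_def)
  have V: "p01 \<in> classical_crossings D" "p02 \<in> classical_crossings D" "p12 \<in> classical_crossings D"
    using classical_crossings_in_disc crossings by (auto simp: p01_def p02_def p12_def)
  have same: "par 0 s < par 0 t \<longleftrightarrow> (if r 0 < 0 then t < s else s < t)"
    "par 1 s < par 1 t \<longleftrightarrow> (if r 1 < 0 then t < s else s < t)"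
    "par 2 s < par 2 t \<longleftrightarrow> (if r 2 < 0 then t < s else s < t)" for s t
    by (rule par_less_par_same, simp add: arcs)+
  have diff: "par 0 s < par 1 t \<longleftrightarrow> c 0 < c 1" "par 1 s < par 0 t \<longleftrightarrow> c 1 < c 0"
    "par 0 s < par 2 t \<longleftrightarrow> c 0 < c 2" "par 1 s < par 2 t \<longleftrightarrow> c 1 < c 2"
    "par 2 s < par 1 t \<longleftrightarrow> c 2 < c 1" if "s \<in> {-1..1}" "t \<in> {-1..1}" for s t
    using that by (intro par_less_par_iff; simp add: arcs)+
  have par: "e / 2 \<in> {-1..1}" "- e / 2 \<in> {-1..1}" "0 \<in> {-1..1 :: real}" using e by auto
  have e_less: "e / 2 < - e / 2 \<longleftrightarrow> \<not> 0 < e" "- e / 2 < e / 2 \<longleftrightarrow> 0 < e" "e / 2 < 0 \<longleftrightarrow> \<not> 0 < e"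
    "0 < e / 2 \<longleftrightarrow> 0 < e" "- e / 2 < 0 \<longleftrightarrow> 0 < e" "0 < - e / 2 \<longleftrightarrow> \<not> 0 < e"
    using e by auto
  have adj: "adjacent G p q \<longleftrightarrow> interlaced D p q" if "p \<in> {p01, p02, p12}" "q \<in> {p01, p02, p12}" for p q
    using that V by (auto simp: G_def adjacent_interlacement[OF diagram])
  have "adjacent G p01 p02 \<longleftrightarrow> interlaced D p01 p02"
    and "adjacent G p01 p12 \<longleftrightarrow> interlaced D p01 p12"
    and "adjacent G p02 p12 \<longleftrightarrow> interlaced D p02 p12"
    by (rule adj; simp)+
  moreover have "interlaced D p01 p02 \<longleftrightarrow>
      (((r 0 < 0) = (0 < e)) \<noteq> (c 1 < c 0)) \<noteq> ((c 0 < c 2) \<noteq> (c 1 < c 2))"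
    using interlaced_inside[OF m(1,2)] ne(1)
    unfolding p01_def p02_def strands same diff[OF par(1,2)] e_less by simp
  moreover have "interlaced D p01 p12 \<longleftrightarrow>
      ((c 0 < c 1) \<noteq> ((r 1 < 0) = (0 < e))) \<noteq> ((c 0 < c 2) \<noteq> (c 1 < c 2))"
    using interlaced_inside[OF m(1,3)] ne(2)
    unfolding p01_def p12_def strands same diff[OF par(1,3)] e_less by simp
  moreover have "interlaced D p02 p12 \<longleftrightarrow>
      ((c 0 < c 1) \<noteq> (c 2 < c 1)) \<noteq> ((c 0 < c 2) \<noteq> ((r 2 < 0) \<noteq> (0 < e)))"
    using interlaced_inside[OF m(2,3)] ne(3)
    unfolding p02_def p12_def strands same diff[OF par(2,3)] e_less by simp
  ultimately show
    "adjacent G p01 p02 \<longleftrightarrow> (((r 0 < 0) = (0 < e)) \<noteq> (c 1 < c 0)) \<noteq> ((c 0 < c 2) \<noteq> (c 1 < c 2))"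
    "adjacent G p01 p12 \<longleftrightarrow> ((c 0 < c 1) \<noteq> ((r 1 < 0) = (0 < e))) \<noteq> ((c 0 < c 2) \<noteq> (c 1 < c 2))"
    "adjacent G p02 p12 \<longleftrightarrow> ((c 0 < c 1) \<noteq> (c 2 < c 1)) \<noteq> ((c 0 < c 2) \<noteq> ((r 2 < 0) \<noteq> (0 < e)))"
    by (simp_all only:)
  have bump: "(bump_arc e has_vector_derivative Complex 1 (-3/4)) (at (e / 2))"
    "(bump_arc e has_vector_derivative Complex 1 (3/4)) (at (- e / 2))"
    unfolding bump_arc_def
    by (rule graph_arc_derivative, use e in \<open>auto intro!: derivative_eq_intros simp: power2_eq_square\<close>)+
  note rising = rising_arc_derivative and falling = falling_arc_derivative
  have par': "e / 2 \<in> {-1<..<1}" "- e / 2 \<in> {-1<..<1}" "0 \<in> {-1<..<1 :: real}" using e by auto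
  note over = R3_over[OF e, of R, folded T]
  have z: "bump_arc e (e / 2) \<in> tangle_crossings T" "bump_arc e (- e / 2) \<in> tangle_crossings T"
    "rising_arc 0 \<in> tangle_crossings T"
    using crossings by simp_all
  show "looped G p01 \<longleftrightarrow> ((r 0 < 0) = (r 1 < 0)) = (\<not> R 0 1)"
    using negative_crossing_of_arcs[OF m(1), unfolded strands over, OF z(1) par'(1) par'(1) bump(1) rising R(1)]
    by (simp add: G_def looped_interlacement p01_def det2_def)
  show "looped G p02 \<longleftrightarrow> ((r 0 < 0) = (r 2 < 0)) = R 0 2"
    using negative_crossing_of_arcs[OF m(2), unfolded strands over, OF z(2) par'(2) par'(2) bump(2) falling R(2)]
    by (simp add: G_def looped_interlacement p02_def det2_def)
  show "looped G p12 \<longleftrightarrow> ((r 1 < 0) = (r 2 < 0)) = R 1 2"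
    using negative_crossing_of_arcs[OF m(3), unfolded strands over, OF z(3) par'(3) par'(3) rising falling R(3)]
    by (simp add: G_def looped_interlacement p12_def det2_def)
qed

end

lemma R3_strands_in_square:
  assumes "e = 1 \<or> e = -1" "i < length (strands (R3_tangle e R))" "s \<in> {-1..1}"
  shows "(strands (R3_tangle e R) ! i) s \<in> model_square"
proof -
  have "i = 0 \<or> i = 1 \<or> i = 2" using assms(2) by (auto simp: R3_tangle_def)
  then show ?thesis
    using assms(1,3) quartic_bounds[OF assms(3)]
    by (auto simp: R3_tangle_def bump_arc_def rising_arc_def falling_arc_def Complex_in_model_square abs_le_iff)
qed

text \<open>The finite check behind the third move: \<open>a\<close>, \<open>b\<close>, \<open>c\<close> record the order of the arcs 0, 1, 2 along
the curve (whether 0 is before 1, 1 before 2, and 0 before 2); \<open>x\<close>, \<open>y\<close>, \<open>z\<close> their directions; and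
\<open>p\<close>, \<open>q\<close>, \<open>r\<close> their heights (whether 0 is over 1, 1 over 2, and 0 over 2). The two assumptions
exclude cyclic heights. The order of the arcs enters only through its parity, which is the cyclic
order of the arcs on the knot. The conclusion is the condition \<open>admissible_triple\<close> for the crossings
of the arcs 0 and 1, of 0 and 2, and of 1 and 2.\<close>

lemma R3_parity:
  fixes a b c x y z p q r :: bool
  assumes "p \<Longrightarrow> q \<Longrightarrow> r" "\<not> p \<Longrightarrow> \<not> q \<Longrightarrow> \<not> r"
    and uv: "uv \<longleftrightarrow> (x \<noteq> (\<not> a)) \<noteq> (c \<noteq> b)"
    and uw: "uw \<longleftrightarrow> (a \<noteq> y) \<noteq> (c \<noteq> b)"
    and vw: "vw \<longleftrightarrow> (a \<noteq> (\<not> b)) \<noteq> (c \<noteq> (\<not> z))"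
    and u: "u \<longleftrightarrow> (x = y) = (\<not> p)" and v: "v \<longleftrightarrow> (x = z) = r" and w: "w \<longleftrightarrow> (y = z) = q"
  shows "if uv = vw \<and> vw = uw then \<not> (u = v \<and> v = w)
    else if uv = vw then u = w \<longrightarrow> v = u
    else if vw = uw then v = u \<longrightarrow> w = v
    else w = v \<longrightarrow> u = w"
proof -
  define k where "k \<longleftrightarrow> (a \<noteq> b) \<noteq> c"
  have uv': "uv \<longleftrightarrow> x = k" and uw': "uw \<longleftrightarrow> y \<noteq> k" and vw': "vw \<longleftrightarrow> z \<noteq> k"
    unfolding uv uw vw k_def by (cases a; cases b; cases c; simp)+
  show ?thesis
    unfolding uv' uw' vw' u v w using assms(1,2)
    by (cases k; cases x; cases y; cases z; cases p; cases q; cases r; simp)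
qed

text \<open>An outer crossing has one of two sides with respect to each of the three arcs, so it separates none
or exactly two of the three pairs of arcs.\<close>

lemma R3_move_equiv:
  assumes D: "knot_diagram D" "knot_diagram D'"
    and rep: "tangle_replacement (R3_tangle 1 R) (R3_tangle (-1) R) D D'"
    and R: "R 0 1 \<longleftrightarrow> \<not> R 1 0" "R 0 2 \<longleftrightarrow> \<not> R 2 0" "R 1 2 \<longleftrightarrow> \<not> R 2 1"
      "R 0 1 \<Longrightarrow> R 1 2 \<Longrightarrow> R 0 2" "R 2 1 \<Longrightarrow> R 1 0 \<Longrightarrow> R 2 0"
  shows "reidemeister_equiv (looped_interlacement_graph D) (looped_interlacement_graph D')"
proof -
  let ?T = "\<lambda>e. R3_tangle e R"
  have len: "length (strands (?T e)) = 3" for e by (simp add: R3_tangle_def)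
  obtain \<phi> c r t0 where "tangle_exchange D D' \<phi> c r (?T 1) (?T (-1)) t0"
    by (rule tangle_replacement_exchange[OF D rep])
      (use R3_strands_in_square[of 1] R3_strands_in_square[of "-1"] in \<open>auto simp: len\<close>)
  then interpret tangle_exchange D D' \<phi> c r "?T 1" "?T (-1)" t0 .
  have Rs: "R 0 1 \<or> R 1 0" "R 0 2 \<or> R 2 0" "R 1 2 \<or> R 2 1" using R by auto
  define u v w where "u = \<phi> (bump_arc 1 (1/2))" "v = \<phi> (bump_arc 1 (-1/2))" "w = \<phi> (rising_arc 0)"
  define u' v' where "u' = \<phi> (bump_arc (-1) (-1/2))" "v' = \<phi> (bump_arc (-1) (1/2))"
  have cross: "tangle_crossings (?T 1) = {bump_arc 1 (1/2), bump_arc 1 (-1/2), rising_arc 0}"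
    "tangle_crossings (?T (-1)) = {bump_arc (-1) (-1/2), bump_arc (-1) (1/2), rising_arc 0}"
    using Rs by (auto simp: R3_crossings)
  define C where "C = classical_crossings D - disc"
  have disc: "u \<in> disc" "v \<in> disc" "w \<in> disc" "u' \<in> disc" "v' \<in> disc"
    using before.tangle_crossing_in_disc after.tangle_crossing_in_disc
    unfolding cross u_v_w_def u'_v'_def by blast+
  have meets: "tangle_meets (?T 1) 0 (1/2) 1 (1/2)" "tangle_meets (?T 1) 0 (-1/2) 2 (-1/2)"
    "tangle_meets (?T 1) 1 0 2 0" "tangle_meets (?T (-1)) 0 (-1/2) 1 (-1/2)"
    "tangle_meets (?T (-1)) 0 (1/2) 2 (1/2)" "tangle_meets (?T (-1)) 1 0 2 0"
    by (simp_all add: R3_meets)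
  have strands: "strands (?T e) ! 0 = bump_arc e" "strands (?T e) ! 1 = rising_arc" for e
    by (simp_all add: R3_tangle_def)
  have C: "x \<in> classical_crossings D" "x \<notin> disc" if "x \<in> C" for x
    using that by (auto simp: C_def)
  have side: "adjacent G x u \<longleftrightarrow> odd_before D t0 x (c 0) \<noteq> odd_before D t0 x (c 1)"
    "adjacent G x v \<longleftrightarrow> odd_before D t0 x (c 0) \<noteq> odd_before D t0 x (c 2)"
    "adjacent G x w \<longleftrightarrow> odd_before D t0 x (c 1) \<noteq> odd_before D t0 x (c 2)"
    "adjacent G' x u' \<longleftrightarrow> odd_before D t0 x (c 0) \<noteq> odd_before D t0 x (c 1)"
    "adjacent G' x v' \<longleftrightarrow> odd_before D t0 x (c 0) \<noteq> odd_before D t0 x (c 2)"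
    "adjacent G' x w \<longleftrightarrow> odd_before D t0 x (c 1) \<noteq> odd_before D t0 x (c 2)" if "x \<in> C" for x
    using adjacent_outside_inside(1)[OF C[OF that] meets(1)] adjacent_outside_inside(1)[OF C[OF that] meets(2)]
      adjacent_outside_inside(1)[OF C[OF that] meets(3)] adjacent_outside_inside(2)[OF C[OF that] meets(4)]
      adjacent_outside_inside(2)[OF C[OF that] meets(5)] adjacent_outside_inside(2)[OF C[OF that] meets(6)]
    unfolding strands u_v_w_def u'_v'_def cross by blast+
  have VG: "verts G = insert u (insert v (insert w C))"
    using verts_G_in_disc unfolding C_def cross by (auto simp: u_v_w_def)
  have VG': "verts G' = insert u' (insert v' (insert w C))"
  proof -
    have "x \<in> verts G' - disc \<longleftrightarrow> x \<in> C" for x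
      using crossings_outside[of x] by (auto simp: C_def)
    then show ?thesis
      using verts_G'_in_disc unfolding cross by (auto simp: u_v_w_def u'_v'_def)
  qed
  have "c 0 \<noteq> c 1" "c 0 \<noteq> c 2" "c 1 \<noteq> c 2"
    using before.par_eq_mod_int[of 0 1 0 0] before.par_eq_mod_int[of 0 2 0 0] before.par_eq_mod_int[of 1 2 0 0]
    by (auto simp: len)
  then have order: "c 1 < c 0 \<longleftrightarrow> \<not> c 0 < c 1" "c 2 < c 1 \<longleftrightarrow> \<not> c 1 < c 2"
    by linarith+
  have e: "(1::real) = 1 \<or> (1::real) = -1" "(-1::real) = 1 \<or> (-1::real) = -1" by simp_all
  have before_graph:
    "adjacent G u v \<longleftrightarrow> ((r 0 < 0) \<noteq> (\<not> c 0 < c 1)) \<noteq> ((c 0 < c 2) \<noteq> (c 1 < c 2))"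
    "adjacent G u w \<longleftrightarrow> ((c 0 < c 1) \<noteq> (r 1 < 0)) \<noteq> ((c 0 < c 2) \<noteq> (c 1 < c 2))"
    "adjacent G v w \<longleftrightarrow> ((c 0 < c 1) \<noteq> (\<not> c 1 < c 2)) \<noteq> ((c 0 < c 2) \<noteq> (\<not> r 2 < 0))"
    "looped G u \<longleftrightarrow> ((r 0 < 0) = (r 1 < 0)) = (\<not> R 0 1)"
    "looped G v \<longleftrightarrow> ((r 0 < 0) = (r 2 < 0)) = R 0 2"
    "looped G w \<longleftrightarrow> ((r 1 < 0) = (r 2 < 0)) = R 1 2"
    using before.R3_graph[OF refl e(1) Rs] unfolding u_v_w_def order by simp_all
  have after_graph:
    "adjacent G' u' v' \<longleftrightarrow> \<not> adjacent G u v" "adjacent G' v' w \<longleftrightarrow> \<not> adjacent G v w"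
    "adjacent G' u' w \<longleftrightarrow> \<not> adjacent G u w"
    "looped G' u' \<longleftrightarrow> looped G u" "looped G' v' \<longleftrightarrow> looped G v" "looped G' w \<longleftrightarrow> looped G w"
    unfolding before_graph using after.R3_graph[OF refl e(2) Rs]
    unfolding u_v_w_def u'_v'_def order
    by simp_all (cases "c 0 < c 2"; cases "c 1 < c 2"; simp)+
  show ?thesis
  proof (rule Omega3_equivI[OF finite_G finite_G' VG VG'])
    show "u \<noteq> v" "v \<noteq> w" "u \<noteq> w" "u' \<noteq> v'" "v' \<noteq> w" "u' \<noteq> w"
      by (auto simp: u_v_w_def u'_v'_def bump_arc_def rising_arc_def)
    show "u \<notin> C" "v \<notin> C" "w \<notin> C" "u' \<notin> C" "v' \<notin> C" "w \<notin> C"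
      using disc by (auto simp: C_def)
    show "adjacent G x y \<longleftrightarrow> adjacent G' x y" if "x \<in> C" "y \<in> C" for x y
      using C[OF that(1)] C[OF that(2)] interlaced_outside crossings_outside
      by (simp add: adjacent_interlacement before.diagram after.diagram)
    show "looped G x \<longleftrightarrow> looped G' x" if "x \<in> C" for x
      using C[OF that] negative_outside by (simp add: looped_interlacement)
    show "admissible_triple G u v w"
      unfolding admissible_triple_def
      by (rule R3_parity[where p = "R 0 1" and q = "R 1 2" and r = "R 0 2",
            OF _ _ before_graph])
        (use R in blast)+
    show "adjacent G x u \<longleftrightarrow> adjacent G' x u'" "adjacent G x v \<longleftrightarrow> adjacent G' x v'"
      "adjacent G x w \<longleftrightarrow> adjacent G' x w" "adjacent G x u = (adjacent G x v \<noteq> adjacent G x w)"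
      if "x \<in> C" for x
      unfolding side[OF that] by (rule refl | blast)+
  qed (rule after_graph)+
qed

lemma axis_arc_in_square: "s \<in> {-1..1} \<Longrightarrow> axis_arc s \<in> model_square"
  by (simp add: axis_arc_def Complex_in_model_square abs_le_iff)

lemma kink_move_equiv:
  assumes D: "knot_diagram D" "knot_diagram D'"
    and rep: "tangle_replacement no_kink (kink P V) D D'"
    and V: "V = {} \<or> V = {kink_arc (1/2)}"
  shows "reidemeister_equiv (looped_interlacement_graph D) (looped_interlacement_graph D')"
proof -
  obtain \<phi> c r t0 where "tangle_exchange D D' \<phi> c r no_kink (kink P V) t0"
    by (rule tangle_replacement_exchange[OF D rep])
      (auto simp: no_kink_def kink_def intro: axis_arc_in_square kink_arc_in_square)
  then interpret tangle_exchange D D' \<phi> c r no_kink "kink P V" t0 .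
  from V show ?thesis
  proof
    assume "V = {}"
    then have "Omega1 G' G"
      using no_kink_crossings
      by (intro Omega1_if_self_crossing[of 0 "1/2" "-1/2"]) (simp_all only: kink_crossings kink_meets, simp_all add: kink_def)
    then show ?thesis
      using finite_G finite_G'
      by (intro reidemeister_equiv_sym[OF reidemeister_equiv_step]) (simp add: reidemeister_step_def)
  next
    assume "V = {kink_arc (1/2)}"
    then have "G = G'"
      by (intro graph_eq_if_no_crossings) (simp_all add: no_kink_crossings kink_crossings)
    then show ?thesis by (simp add: reidemeister_equiv_refl)
  qed
qed

lemma R2_strands_in_square:
  assumes "s \<in> {-1..1}"
  shows "high_arc s \<in> model_square" "dip_arc s \<in> model_square"
  using quartic_bounds[OF assms] assms
  unfolding high_arc_def dip_arc_def Complex_in_model_square abs_le_iff atLeastAtMost_iff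
  by (intro conjI; linarith)+

text \<open>This covers the classical and the virtual second move. In the classical one the arc that dips
crosses the axis once downwards and once upwards, always above or always below it, and so the two
signs are opposite; which of the two crossings is the negative one depends on the directions and on
the heights.\<close>

lemma R2_move_equiv:
  assumes D: "knot_diagram D" "knot_diagram D'"
    and rep: "tangle_replacement (fst (R2_pair R)) (snd (R2_pair R)) D D'"
  shows "reidemeister_equiv (looped_interlacement_graph D) (looped_interlacement_graph D')"
proof -
  let ?T = "tangle_of [high_arc, axis_arc] R" and ?T' = "tangle_of [dip_arc, axis_arc] R"
  have rep': "tangle_replacement ?T ?T' D D'" using rep by (simp add: R2_pair_def)
  obtain \<phi> c r t0 where "tangle_exchange D D' \<phi> c r ?T ?T' t0"
  proof (rule tangle_replacement_exchange[OF D rep'])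
    fix i s assume "i < length (strands ?T)" and s: "s \<in> {-1..1::real}"
    then have "i = 0 \<or> i = 1" by auto
    then show "(strands ?T ! i) s \<in> model_square" "(strands ?T' ! i) s \<in> model_square"
      using axis_arc_in_square[OF s] R2_strands_in_square[OF s] by auto
  qed simp_all
  then interpret tangle_exchange D D' \<phi> c r ?T ?T' t0 .
  show ?thesis
  proof (cases "R 0 1 \<or> R 1 0")
    case False
    then have "G = G'"
      by (intro graph_eq_if_no_crossings) (simp_all add: R2_before_crossings R2_crossings)
    then show ?thesis by (simp add: reidemeister_equiv_refl)
  next
    case True
    have strands: "strands ?T' ! 0 = dip_arc" "strands ?T' ! 1 = axis_arc" by simp_all
    have m: "tangle_meets ?T' 0 s 1 s" if "s = 1/2 \<or> s = -1/2" for s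
      using that by (simp add: R2_meets)
    have Re: "\<forall>a\<in>set [dip_arc, axis_arc]. \<forall>s. Re (a s) = s"
      by (simp add: dip_arc_def axis_arc_def)
    have over: "(0, s) \<in> tangle_over ?T' \<longleftrightarrow> R 0 1" "(1, s) \<in> tangle_over ?T' \<longleftrightarrow> R 1 0"
      if "s = 1/2 \<or> s = -1/2" for s
      unfolding tangle_of_over[OF Re] R2_meets using that by auto
    have crossings: "tangle_crossings ?T' = {dip_arc (1/2), dip_arc (-1/2)}"
      using True by (simp only: R2_crossings if_True)
    have dip: "(dip_arc has_vector_derivative Complex 1 (4 * s * (1 - s^2))) (at s)" for s
      unfolding dip_arc_def
      by (rule graph_arc_derivative) (auto intro!: derivative_eq_intros)
    have axis: "(axis_arc has_vector_derivative Complex 1 0) (at s)" for s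
      unfolding axis_arc_def by (rule graph_arc_derivative) simp
    have sign: "negative_crossing D' (\<phi> (dip_arc s)) \<longleftrightarrow> ((r 0 < 0) = (r 1 < 0)) = (R 0 1 \<longleftrightarrow> 0 < s)"
      if s: "s = 1/2 \<or> s = -1/2" for s
    proof -
      have det: "det2 (Complex 1 (4 * s * (1 - s^2))) (Complex 1 0) = - 3 * s"
        using s by (elim disjE) (simp_all only:, simp_all add: det2_def power2_eq_square)
      have "dip_arc s \<in> tangle_crossings ?T'" "s \<in> {-1<..<1}" "- 3 * s \<noteq> 0" "R 0 1 \<or> R 1 0"
      proof -
        show "dip_arc s \<in> tangle_crossings ?T'" unfolding crossings using s by blast
      qed (use s True in auto)
      from after.negative_crossing_of_arcs[OF m[OF s], unfolded strands over[OF s] det,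
          OF this(1,2,2) dip axis this(4), unfolded det, OF this(3)]
      show ?thesis by simp
    qed
    (* The looped vertex has to be named first. *)
    have "\<exists>s s'. {dip_arc s, dip_arc s'} = {dip_arc (1/2), dip_arc (-1/2)} \<and> (s = 1/2 \<or> s = -1/2) \<and>
        (s' = 1/2 \<or> s' = -1/2) \<and> negative_crossing D' (\<phi> (dip_arc s)) \<and> \<not> negative_crossing D' (\<phi> (dip_arc s'))"
    proof (cases "negative_crossing D' (\<phi> (dip_arc (1/2)))")
      case True
      moreover from this have "\<not> negative_crossing D' (\<phi> (dip_arc (-1/2)))"
        using sign[of "1/2"] sign[of "-1/2"] by simp
      ultimately show ?thesis by (intro exI[of _ "1/2"] exI[of _ "-1/2"]) blast
    next
      case False
      moreover from this have "negative_crossing D' (\<phi> (dip_arc (-1/2)))"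
        using sign[of "1/2"] sign[of "-1/2"] by simp
      ultimately show ?thesis by (intro exI[of _ "-1/2"] exI[of _ "1/2"]) blast
    qed
    then obtain s s' where ss': "{dip_arc s, dip_arc s'} = {dip_arc (1/2), dip_arc (-1/2)}"
      "s = 1/2 \<or> s = -1/2" "s' = 1/2 \<or> s' = -1/2"
      "negative_crossing D' (\<phi> (dip_arc s))" "\<not> negative_crossing D' (\<phi> (dip_arc s'))"
      by blast
    have "Omega2 G' G"
      by (rule Omega2_if_two_crossings[OF R2_before_crossings _ m[OF ss'(2)] m[OF ss'(3)], unfolded strands])
        (use ss' crossings in simp_all)
    then show ?thesis
      using finite_G finite_G'
      by (intro reidemeister_equiv_sym[OF reidemeister_equiv_step]) (simp add: reidemeister_step_def)
  qed
qed

text \<open>If the arc 0 has only virtual crossings, then at most the crossing of the arcs 1 and 2 is a vertex,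
and the move does not touch it.\<close>

lemma mixed_move_equiv:
  assumes D: "knot_diagram D" "knot_diagram D'"
    and rep: "tangle_replacement (R3_tangle 1 R) (R3_tangle (-1) R) D D'"
    and R: "\<not> R 0 1" "\<not> R 1 0" "\<not> R 0 2" "\<not> R 2 0"
  shows "reidemeister_equiv (looped_interlacement_graph D) (looped_interlacement_graph D')"
proof -
  let ?T = "\<lambda>e. R3_tangle e R"
  have len: "length (strands (?T e)) = 3" for e by (simp add: R3_tangle_def)
  obtain \<phi> c r t0 where "tangle_exchange D D' \<phi> c r (?T 1) (?T (-1)) t0"
    by (rule tangle_replacement_exchange[OF D rep])
      (use R3_strands_in_square[of 1] R3_strands_in_square[of "-1"] in \<open>auto simp: len\<close>)
  then interpret tangle_exchange D D' \<phi> c r "?T 1" "?T (-1)" t0 .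
  have "G = G'"
  proof (cases "R 1 2 \<or> R 2 1")
    case False
    then show ?thesis using R by (intro graph_eq_if_no_crossings) (simp_all add: R3_crossings)
  next
    case True
    have strands: "strands (?T e) ! 1 = rising_arc" "strands (?T e) ! 2 = falling_arc" for e
      by (simp_all add: R3_tangle_def)
    have m: "tangle_meets (?T 1) 1 0 2 0" "tangle_meets (?T (-1)) 1 0 2 0" by (simp_all add: R3_meets)
    have crossings: "tangle_crossings (?T 1) = {rising_arc 0}" "tangle_crossings (?T (-1)) = {rising_arc 0}"
      using R True by (simp_all add: R3_crossings)
    have e: "(1::real) = 1 \<or> (1::real) = -1" "(-1::real) = 1 \<or> (-1::real) = -1" by simp_all
    note over = R3_over(5,6)[OF e(1), of R] R3_over(5,6)[OF e(2), of R]
    have rising: "(rising_arc has_vector_derivative Complex 1 (9/16)) (at 0)"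
      and falling: "(falling_arc has_vector_derivative Complex 1 (-9/16)) (at 0)"
      by (rule rising_arc_derivative falling_arc_derivative)+
    have zero: "(0::real) \<in> {-1<..<1}" by simp
    have z: "rising_arc 0 \<in> tangle_crossings (?T 1)" "rising_arc 0 \<in> tangle_crossings (?T (-1))"
      by (simp_all add: crossings)
    have det: "det2 (Complex 1 (9/16)) (Complex 1 (-9/16)) \<noteq> 0" by (simp add: det2_def)
    have "negative_crossing D' (\<phi> (rising_arc 0)) \<longleftrightarrow> negative_crossing D (\<phi> (rising_arc 0))"
      using before.negative_crossing_of_arcs[OF m(1), unfolded strands over, OF z(1) zero zero rising falling True det]
        after.negative_crossing_of_arcs[OF m(2), unfolded strands over, OF z(2) zero zero rising falling True det]
      by simp
    then show ?thesis
      by (intro graph_eq_if_same_crossing[OF crossings m]) (simp_all only: strands)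
  qed
  then show ?thesis by (simp add: reidemeister_equiv_refl)
qed

text \<open>In a classical third move the relation between the arcs comes from heights and is therefore not cyclic.\<close>

lemma tangle_replacement_equiv:
  assumes D: "knot_diagram D" "knot_diagram D'" and rep: "tangle_replacement T T' D D'"
    and move: "(T, T') \<in> virtual_moves"
  shows "reidemeister_equiv (looped_interlacement_graph D) (looped_interlacement_graph D')"
proof -
  have R3: ?thesis if T: "(T, T') = R3_pair (\<lambda>i j. h i > h j)" and h: "inj_on h {0, 1, 2}" for h :: "nat \<Rightarrow> nat"
  proof (rule R3_move_equiv[OF D])
    show "tangle_replacement (R3_tangle 1 (\<lambda>i j. h i > h j)) (R3_tangle (-1) (\<lambda>i j. h i > h j)) D D'"
      using rep T by (simp add: R3_pair_eq)
    have "h 0 \<noteq> h 1" "h 0 \<noteq> h 2" "h 1 \<noteq> h 2" using h by (auto simp: inj_on_def)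
    then show "h 0 > h 1 \<longleftrightarrow> \<not> h 1 > h 0" "h 0 > h 2 \<longleftrightarrow> \<not> h 2 > h 0" "h 1 > h 2 \<longleftrightarrow> \<not> h 2 > h 1"
      by linarith+
  qed linarith+
  have mixed: ?thesis if T: "(T, T') = R3_pair R" and R: "\<not> R 0 1" "\<not> R 1 0" "\<not> R 0 2" "\<not> R 2 0" for R
    using mixed_move_equiv[OF D _ R] rep T by (simp add: R3_pair_eq)
  have R2: ?thesis if "(T, T') = R2_pair R" for R
    using R2_move_equiv[OF D, of R] rep that[symmetric] by simp
  have kink: ?thesis if "T = no_kink" "T' = kink P V" "V = {} \<or> V = {kink_arc (1/2)}" for P V
    using kink_move_equiv[OF D _ that(3)] rep that(1,2) by simp
  from move consider "(T, T') \<in> R1_moves" | "(T, T') \<in> virtual_R1_moves" | "(T, T') \<in> R2_moves"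
    | "(T, T') \<in> virtual_R2_moves" | "(T, T') \<in> R3_moves" | "(T, T') \<in> virtual_R3_moves"
    | "(T, T') \<in> mixed_moves"
    unfolding virtual_moves_def classical_moves_def by blast
  then show ?thesis
  proof cases
    case 1 then show ?thesis using kink unfolding R1_moves_def by auto
  next
    case 2 then show ?thesis using kink unfolding virtual_R1_moves_def by auto
  next
    case 3 then show ?thesis using R2 unfolding R2_moves_def by blast
  next
    case 4 then show ?thesis using R2 unfolding virtual_R2_moves_def by blast
  next
    case 5 then show ?thesis using R3 unfolding R3_moves_def by blast
  next
    case 6 then show ?thesis using mixed[of "\<lambda>i j. False"] unfolding virtual_R3_moves_def by simp
  next
    case 7
    then consider "(T, T') = R3_pair (\<lambda>i j. i = 1 \<and> j = 2)" | "(T, T') = R3_pair (\<lambda>i j. i = 2 \<and> j = 1)"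
      unfolding mixed_moves_def by blast
    then show ?thesis
    proof cases
      case 1 then show ?thesis by (rule mixed) simp_all
    next
      case 2 then show ?thesis by (rule mixed) simp_all
    qed
  qed
qed

lemma diagram_step_equiv:
  assumes "diagram_step virtual_moves D D'"
  shows "reidemeister_equiv (looped_interlacement_graph D) (looped_interlacement_graph D')"
proof -
  have D: "knot_diagram D" "knot_diagram D'" using assms by (auto simp: diagram_step_def)
  from assms consider "reparametrization D D'" | "planar_isotopy D D'"
    | T T' where "(T, T') \<in> virtual_moves" "tangle_replacement T T' D D'"
    unfolding diagram_step_def by blast
  then show ?thesis
  proof cases
    case 1
    then show ?thesis
      using reparametrization_interlacement_eq[OF D] by (simp add: reidemeister_equiv_refl)
  next
    case 2
    then show ?thesis
      using planar_isotopy_interlacement_iso[OF D] finite_interlacement D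
      by (intro reidemeister_equiv_step) (simp add: reidemeister_step_def)
  next
    case 3
    then show ?thesis using tangle_replacement_equiv[OF D] by blast
  qed
qed

lemma diagram_steps_equiv:
  assumes "equivclp r D D'" and "\<And>E E'. r E E' \<Longrightarrow> diagram_step virtual_moves E E'"
  shows "reidemeister_equiv (looped_interlacement_graph D) (looped_interlacement_graph D')"
  using assms(1)
proof (induction rule: equivclp_induct)
  case base
  show ?case by (rule reidemeister_equiv_refl)
next
  case (step E E')
  then have "reidemeister_equiv (looped_interlacement_graph E) (looped_interlacement_graph E')"
    using assms(2) diagram_step_equiv reidemeister_equiv_sym by blast
  with step.IH show ?case by (rule reidemeister_equiv_trans)
qed

theorem theorem2:
  fixes D1 D2 :: diagram
  assumes "knot_diagram D1" and "knot_diagram D2"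
    and "same_classical_knot D1 D2 \<or> same_virtual_knot D1 D2"
  shows "reidemeister_equiv (looped_interlacement_graph D1) (looped_interlacement_graph D2)"
  using assms(3)
proof
  assume "same_classical_knot D1 D2"
  then have "equivclp (\<lambda>E E'. classical_diagram E \<and> classical_diagram E' \<and>
      diagram_step classical_moves E E') D1 D2"
    by (simp add: same_classical_knot_def)
  then show ?thesis
    by (rule diagram_steps_equiv) (auto simp: diagram_step_def virtual_moves_def)
next
  assume "same_virtual_knot D1 D2"
  then have "equivclp (diagram_step virtual_moves) D1 D2"
    by (simp add: same_virtual_knot_def)
  then show ?thesis by (rule diagram_steps_equiv)
qed

end
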